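(* Let $\phi:B_E\to B_E$ be analytic and assume that the composition operator $C_\phi:\mathcal B(B_E)\to\mathcal B(B_E)$, $C_\phi f=f\circ\phi$, is compact. Then (1) $\phi(\delta B_E)$ is relatively compact in $E$ for each $0<\delta<1$; (2) $\displaystyle\lim_{\|\phi(z)\|\to 1}\frac{(1- \|z\|^2) \|\mathcal R \phi(z)\|}{\sqrt{1- \|\phi(z)\|^2}}=0$; and (3) $\displaystyle\lim_{\|\phi(z)\|\to 1}\frac{(1- \|z\|^2) |\langle \phi(z), \mathcal R\phi(z)\rangle|}{1- \|\phi(z)\|^2}=0$.
   Context: $E$ is a complex Hilbert space of arbitrary dimension with inner product $\langle\cdot,\cdot\rangle$ and open unit ball $B_E$. For an analytic map $\phi:B_E\to E$, $\mathcal R\phi(x)=\phi'(x)(x)$ is its radial derivative. A limit $\lim_{\|\phi(z)\|\to 1} Q(z)=0$ means: for every $\varepsilon>0$ there is $r<1$ such that $|Q(z)|<\varepsilon$ whenever $\|\phi(z)\|>r$. The Bloch space $\mathcal B(B_E)$ is the space of analytic $f:B_E\to\mathbb C$ with $\|f\|_{\mathcal B(B_E)}=\sup_{x\in B_E}(1-\|x\|^2)\|f'(x)\|<\infty$, a Banach space under the norm $\|f\|_{Bloch(B_E)}=|f(0)|+\|f\|_{inv}$, where $\|f\|_{inv}=\sup_{x\in B_E}\|\nabla(f\circ\varphi_x)(0)\|$ (an equivalent seminorm), $\nabla g(x)$ being the gradient vector representing $g'(x)$ and $\varphi_x$ the Möbius automorphism of $B_E$ exchanging $0$ and $x$: $\varphi_a(y)=(s_aQ_a+P_a)\big(\frac{a-y}{1-\langle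 y,a\rangle}\big)$, $s_a=\sqrt{1-\|a\|^2}$, $P_a$ the orthogonal projection onto $\mathbb Ca$, $Q_a=I-P_a$. *)

theory Defs
  imports "HOL-Analysis.Analysis"
begin

class chilbert_space = real_normed_vector + complete_space +
  fixes cscale :: "complex \<Rightarrow> 'a \<Rightarrow> 'a"
    and cinner :: "'a \<Rightarrow> 'a \<Rightarrow> complex"
  assumes cscale_add_right: "cscale c (x + y) = cscale c x + cscale c y"
    and cscale_add_left: "cscale (b + c) x = cscale b x + cscale c x"
    and cscale_cscale: "cscale b (cscale c x) = cscale (b * c) x"
    and cscale_of_real: "cscale (complex_of_real r) x = r *\<^sub>R x"
    and cinner_add_left: "cinner (x + y) z = cinner x z + cinner y z"
    and cinner_cscale_left: "cinner (cscale c x) y = c * cinner x y"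
    and cinner_commute: "cinner y x = cnj (cinner x y)"
    and cinner_self: "cinner x x = complex_of_real ((norm x)\<^sup>2)"

definition holo_vec :: "'a::chilbert_space set \<Rightarrow> ('a \<Rightarrow> 'a) \<Rightarrow> bool" where
  "holo_vec U f \<longleftrightarrow> (\<forall>x\<in>U. \<exists>L. (f has_derivative L) (at x) \<and>
      (\<forall>c v. L (cscale c v) = cscale c (L v)))"

definition holo_fun :: "'a::chilbert_space set \<Rightarrow> ('a \<Rightarrow> complex) \<Rightarrow> bool" where
  "holo_fun U f \<longleftrightarrow> (\<forall>x\<in>U. \<exists>L. (f has_derivative L) (at x) \<and>
      (\<forall>c v. L (cscale c v) = c * L v))"

definition fderiv :: "('a::real_normed_vector \<Rightarrow> 'b::real_normed_vector) \<Rightarrow> 'a \<Rightarrow> 'a \<Rightarrow> 'b" where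
  "fderiv f x = (SOME L. (f has_derivative L) (at x))"

definition radial_deriv :: "('a::chilbert_space \<Rightarrow> 'a) \<Rightarrow> 'a \<Rightarrow> 'a" where
  "radial_deriv \<phi> x = fderiv \<phi> x x"

definition bloch :: "('a::chilbert_space \<Rightarrow> complex) set" where
  "bloch = {f. holo_fun (ball 0 1) f \<and>
      bdd_above ((\<lambda>x. (1 - (norm x)\<^sup>2) * onorm (fderiv f x)) ` ball 0 1)}"

definition projP :: "'a::chilbert_space \<Rightarrow> 'a \<Rightarrow> 'a" where
  "projP a y = (if a = 0 then 0 else cscale (cinner y a / complex_of_real ((norm a)\<^sup>2)) a)"

definition projQ :: "'a::chilbert_space \<Rightarrow> 'a \<Rightarrow> 'a" where
  "projQ a y = y - projP a y"

text \<open>Moebius automorphism exchanging 0 and a.\<close>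
definition mobius :: "'a::chilbert_space \<Rightarrow> 'a \<Rightarrow> 'a" where
  "mobius a y = (let w = cscale (inverse (1 - cinner y a)) (a - y)
                 in sqrt (1 - (norm a)\<^sup>2) *\<^sub>R projQ a w + projP a w)"

text \<open>The Bloch norm |f(0)| + ||f||_inv; the norm of the gradient equals the operator norm
  of the derivative (Riesz).\<close>
definition bloch_norm :: "('a::chilbert_space \<Rightarrow> complex) \<Rightarrow> real" where
  "bloch_norm f = cmod (f 0) + (SUP x\<in>ball 0 1. onorm (fderiv (f \<circ> mobius x) 0))"

definition compact_comp_op :: "('a::chilbert_space \<Rightarrow> 'a) \<Rightarrow> bool" where
  "compact_comp_op \<phi> \<longleftrightarrow>
     (\<forall>f\<in>bloch. f \<circ> \<phi> \<in> bloch) \<and>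
     (\<forall>F :: nat \<Rightarrow> 'a \<Rightarrow> complex. (\<forall>n. F n \<in> bloch) \<and> (\<exists>M::real. \<forall>n. bloch_norm (F n) \<le> M) \<longrightarrow>
        (\<exists>(r::nat \<Rightarrow> nat) g. strict_mono r \<and> g \<in> bloch \<and>
           (\<lambda>n. bloch_norm (\<lambda>z. (F (r n) \<circ> \<phi>) z - g z)) \<longlonglongrightarrow> 0))"

end

theory Submission
  imports Defs "HOL-Complex_Analysis.Cauchy_Integral_Formula"
begin

text \<open>
  Convergence in the Bloch norm controls \<open>(1 - \<parallel>x\<parallel>\<^sup>2) \<parallel>f'(x)\<parallel>\<close>
  uniformly. For the limits (2) and (3), suppose that they fail along \<open>z\<^sub>n\<close> and put
  \<open>a = \<phi>(z\<^sub>n)\<close>. The functions \<open>(1 - \<parallel>a\<parallel>\<^sup>2) / (1 - \<langle>y,a\<rangle>)\<close> and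
  \<open>sqrt (1 - \<parallel>a\<parallel>\<^sup>2) \<langle>y,u\<rangle> / (1 - \<langle>y,a\<rangle>)\<close>, with \<open>u\<close> a unit
  vector orthogonal to \<open>a\<close>, are bounded in the Bloch space, and their derivatives tend to
  zero pointwise as \<open>\<parallel>a\<parallel>\<close> tends to 1. By compactness a subsequence of their compositions
  with \<open>\<phi>\<close> converges, necessarily to a constant, so their weighted radial derivatives at
  \<open>z\<^sub>n\<close> tend to zero; these are the radial and the tangential part of the quotients in
  question. Part (1) follows in the same way from the functionals \<open>\<langle>y,u\<rangle>\<close> by Schauder's
  argument.

  The supremum defining the invariant seminorm is a junk value unless it is finite. Finiteness
  on the whole Bloch space rests on the fact that derivatives of Bloch functions grow only like
  \<open>1 / sqrt (1 - \<parallel>x\<parallel>)\<close> in directions orthogonal to \<open>x\<close>.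
\<close>

section \<open>Complex inner products\<close>

lemma cscale_0_left [simp]: "cscale 0 x = 0"
  using cscale_of_real[of 0 x] by simp

lemma cscale_1_left [simp]: "cscale 1 x = x"
  using cscale_of_real[of 1 x] by simp

lemma cscale_scaleR_left: "cscale (r *\<^sub>R c) x = r *\<^sub>R cscale c x"
  by (simp add: scaleR_conv_of_real flip: cscale_cscale cscale_of_real)

lemma cscale_scaleR_right: "cscale c (r *\<^sub>R x) = r *\<^sub>R cscale c x"
  by (simp add: cscale_cscale mult.commute flip: cscale_of_real)

lemma cscale_0_right [simp]: "cscale c 0 = 0"
  using cscale_scaleR_right[of c 0 0] by simp

lemma cinner_add_right: "cinner x (y + z) = cinner x y + cinner x z"
  using cinner_commute[of x "y + z"] cinner_commute[of x y] cinner_commute[of x z]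
  by (simp add: cinner_add_left)

lemma cinner_0_left [simp]: "cinner 0 x = 0"
  using cinner_cscale_left[of 0 0 x] by simp

lemma cinner_0_right [simp]: "cinner x 0 = 0"
  using cinner_commute[of x 0] by simp

lemma cinner_cscale_right: "cinner x (cscale c y) = cnj c * cinner x y"
  using cinner_commute[of x "cscale c y"] cinner_commute[of x y] by (simp add: cinner_cscale_left)

lemma cinner_minus_left [simp]: "cinner (- x) y = - cinner x y"
  using cinner_add_left[of x "- x" y] by (simp add: eq_neg_iff_add_eq_0 add.commute)

lemma cinner_diff_left: "cinner (x - y) z = cinner x z - cinner y z"
  using cinner_add_left[of x "- y" z] by simp

lemma cinner_scaleR_left: "cinner (r *\<^sub>R x) y = of_real r * cinner x y"
  using cinner_cscale_left[of "of_real r" x y] by (simp add: cscale_of_real)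

lemma cinner_scaleR_right: "cinner x (r *\<^sub>R y) = of_real r * cinner x y"
  using cinner_cscale_right[of x "of_real r" y] by (simp add: cscale_of_real)

lemma norm_add_orthogonal:
  assumes "cinner x y = 0"
  shows "(norm (x + y))\<^sup>2 = (norm x)\<^sup>2 + (norm y)\<^sup>2"
proof -
  have "cinner y x = 0" using cinner_commute[of y x] assms by simp
  then have "complex_of_real ((norm (x + y))\<^sup>2) = complex_of_real ((norm x)\<^sup>2 + (norm y)\<^sup>2)"
    using cinner_self[of "x + y"] assms cinner_self[of x] cinner_self[of y]
    by (simp add: cinner_add_left cinner_add_right)
  then show ?thesis by (simp only: of_real_eq_iff)
qed

lemma norm_cscale: "norm (cscale c x) = cmod c * norm x"
proof -
  have "complex_of_real ((norm (cscale c x))\<^sup>2) = complex_of_real ((cmod c * norm x)\<^sup>2)"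
    unfolding cinner_self[symmetric] of_real_mult power_mult_distrib complex_norm_square
    by (simp add: cinner_cscale_left cinner_cscale_right)
  then have "(norm (cscale c x))\<^sup>2 = (cmod c * norm x)\<^sup>2" by (simp only: of_real_eq_iff)
  then show ?thesis by (simp add: power2_eq_iff_nonneg)
qed

lemma projQ_cinner [simp]: "cinner (projQ a v) a = 0"
  by (simp add: projQ_def projP_def cinner_diff_left cinner_cscale_left cinner_self)

lemma projQ_projP_cinner [simp]: "cinner (projQ a v) (projP a w) = 0"
  by (simp add: projP_def cinner_cscale_right)

lemma projP_projQ_cinner [simp]: "cinner (projP a v) (projQ a w) = 0"
  using cinner_commute[of "projP a v" "projQ a w"] by simp

lemma norm_projQ_projP: "(norm v)\<^sup>2 = (norm (projQ a v))\<^sup>2 + (norm (projP a v))\<^sup>2"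
  using norm_add_orthogonal[OF projQ_projP_cinner[of a v v]] unfolding projQ_def diff_add_cancel .

lemma norm_projQ_le: "norm (projQ a v) \<le> norm v"
  by (rule power2_le_imp_le) (simp_all add: norm_projQ_projP[of v a])

lemma norm_projP_le: "norm (projP a v) \<le> norm v"
  by (rule power2_le_imp_le) (simp_all add: norm_projQ_projP[of v a])

text \<open>The product form covers \<open>a = 0\<close>, where \<open>projP\<close> is 0 by
  definition, without a division.\<close>

lemma norm_projP: "norm a * norm (projP a v) = cmod (cinner v a)"
  by (cases "a = 0") (simp_all add: projP_def norm_cscale norm_divide norm_mult power2_eq_square)

text \<open>Pythagoras makes the projection onto the line of \<open>y\<close> a contraction, and
  \<open>norm y\<close> times the length of the projected \<open>x\<close> is the modulus of the
  inner product.\<close>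

lemma cinner_Cauchy_Schwarz: "cmod (cinner x y) \<le> norm x * norm y"
  using mult_left_mono[OF norm_projP_le[of y x], of "norm y"] norm_projP[of y x]
  by (simp add: mult.commute)

text \<open>The product with \<open>v\<close> sees only the component of \<open>y\<close> orthogonal
  to \<open>a\<close>, the product with \<open>a\<close> only the component along \<open>a\<close>;
  Pythagoras adds the squares. This later bounds the numerator of a tangential test function by its
  denominator.\<close>

lemma cinner_bessel2:
  assumes "cinner v a = 0" "norm v \<le> 1" "norm a \<le> 1"
  shows "(cmod (cinner y v))\<^sup>2 \<le> (norm y)\<^sup>2 - (cmod (cinner y a))\<^sup>2"
proof -
  have "cinner (projP a y) v = 0"
    using assms(1) cinner_commute[of a v] by (simp add: projP_def cinner_cscale_left)
  then have "cinner y v = cinner (projQ a y) v"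
    by (simp add: projQ_def cinner_diff_left)
  then have "cmod (cinner y v) \<le> norm (projQ a y)"
    using cinner_Cauchy_Schwarz[of "projQ a y" v] mult_left_le[OF assms(2) norm_ge_zero[of "projQ a y"]]
    by simp
  then have "(cmod (cinner y v))\<^sup>2 \<le> (norm (projQ a y))\<^sup>2" by (simp add: power_mono)
  moreover have "cmod (cinner y a) \<le> norm (projP a y)"
    using norm_projP[of a y] mult_right_mono[OF assms(3), of "norm (projP a y)"] by simp
  then have "(cmod (cinner y a))\<^sup>2 \<le> (norm (projP a y))\<^sup>2" by (simp add: power_mono)
  ultimately show ?thesis using norm_projQ_projP[of y a] by linarith
qed

text \<open>Lower bounds, by Cauchy-Schwarz, for the denominator of the test functions. The first is
  uniform in \<open>a\<close> and yields pointwise decay as \<open>a\<close> approaches the sphere;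
  both together yield Bloch bounds uniform in \<open>a\<close>.\<close>

lemma cinner_near_1:
  assumes "norm a < 1" "norm y < 1"
  shows "1 - norm y \<le> cmod (1 - cinner y a)" "1 - norm a \<le> cmod (1 - cinner y a)"
    "cinner y a \<noteq> 1"
proof -
  have c: "cmod (cinner y a) \<le> norm y * norm a" by (rule cinner_Cauchy_Schwarz)
  have "norm y * norm a \<le> norm y" "norm y * norm a \<le> norm a"
    using assms by (simp_all add: mult_left_le mult_left_le_one_le)
  then show "1 - norm y \<le> cmod (1 - cinner y a)" "1 - norm a \<le> cmod (1 - cinner y a)"
    using norm_triangle_ineq2[of 1 "cinner y a"] c by auto
  then show "cinner y a \<noteq> 1" using assms by auto
qed

lemma bounded_linear_cinner_left: "bounded_linear (\<lambda>x. cinner x y)"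
  by (rule bounded_linear_intro[of _ "norm y"])
    (auto simp: cinner_add_left cinner_scaleR_left cinner_Cauchy_Schwarz scaleR_conv_of_real)

lemma bounded_bilinear_cscale: "bounded_bilinear cscale"
  by unfold_locales
    (auto simp: cscale_add_left cscale_add_right cscale_scaleR_left cscale_scaleR_right norm_cscale
      intro!: exI[of _ 1])

lemma bounded_linear_projP: "bounded_linear (projP a)"
proof (rule bounded_linear_intro[of _ 1])
  show "projP a (x + y) = projP a x + projP a y" for x y
    by (simp add: projP_def cinner_add_left add_divide_distrib cscale_add_left)
  show "projP a (r *\<^sub>R x) = r *\<^sub>R projP a x" for r x
    using cscale_scaleR_left[of r "cinner x a / complex_of_real ((norm a)\<^sup>2)" a]
    by (simp add: projP_def cinner_scaleR_left scaleR_conv_of_real)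
qed (simp add: norm_projP_le)

lemma bounded_linear_projQ: "bounded_linear (projQ a)"
  unfolding projQ_def[abs_def] by (intro bounded_linear_sub bounded_linear_ident bounded_linear_projP)

lemmas has_derivative_cinner_left = bounded_linear.has_derivative[OF bounded_linear_cinner_left]

section \<open>The derivative of a Moebius automorphism at the origin\<close>

lemma mobius_0 [simp]: "mobius a 0 = a"
proof -
  have "projP a a = a" by (simp add: projP_def cinner_self)
  then show ?thesis by (simp add: mobius_def projQ_def)
qed

text \<open>Differentiating the scalar factor gives the rank one term
  \<open>cscale (cinner v a) a\<close>, which is \<open>(norm a)\<^sup>2\<close> times the
  projection of \<open>v\<close>. It lowers the radial coefficient from 1 to
  \<open>1 - (norm a)\<^sup>2\<close>, while the tangential part is multiplied only by the square
  root of that number.\<close>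

lemma mobius_has_derivative_0:
  fixes a :: "'a::chilbert_space"
  assumes "norm a < 1"
  shows "(mobius a has_derivative
      (\<lambda>v. - (sqrt (1 - (norm a)\<^sup>2) *\<^sub>R projQ a v + (1 - (norm a)\<^sup>2) *\<^sub>R projP a v))) (at 0)"
proof -
  define T where "T = (\<lambda>w. sqrt (1 - (norm a)\<^sup>2) *\<^sub>R projQ a w + projP a w)"
  have T: "bounded_linear T" unfolding T_def
    by (intro bounded_linear_add bounded_linear_compose[OF bounded_linear_scaleR_right]
        bounded_linear_projP bounded_linear_projQ)
  interpret T: bounded_linear T by (rule T)
  have "((\<lambda>y. cscale (inverse (1 - cinner y a)) (a - y)) has_derivative
      (\<lambda>v. cscale (inverse (1 - cinner 0 a)) (0 - v)
        + cscale (- (inverse (1 - cinner 0 a) * (0 - cinner v a) * inverse (1 - cinner 0 a))) (a - 0))) (at 0)"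
    by (intro bounded_bilinear.FDERIV[OF bounded_bilinear_cscale] derivative_intros
        has_derivative_cinner_left) auto
  then have "((\<lambda>y. T (cscale (inverse (1 - cinner y a)) (a - y))) has_derivative
      (\<lambda>v. T (- v + cscale (cinner v a) a))) (at 0)"
    by (auto intro!: T.has_derivative)
  moreover have "T (- v + cscale (cinner v a) a)
      = - (sqrt (1 - (norm a)\<^sup>2) *\<^sub>R projQ a v + (1 - (norm a)\<^sup>2) *\<^sub>R projP a v)" for v
  proof -
    have aa: "projP a (cscale c a) = cscale c a" for c
      by (simp add: projP_def cinner_self cinner_cscale_left)
    have "T (cscale (cinner v a) a) = cscale (cinner v a) a"
      by (simp add: T_def projQ_def aa)
    moreover have "cscale (cinner v a) a = (norm a)\<^sup>2 *\<^sub>R projP a v"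
      by (simp add: projP_def cscale_cscale flip: cscale_of_real)
    ultimately show ?thesis
      by (simp only: T.add T.neg) (simp add: T_def algebra_simps)
  qed
  ultimately show ?thesis
    by (simp add: mobius_def[abs_def] Let_def T_def)
qed

section \<open>Bloch functions\<close>

lemma fderiv_eq: "(f has_derivative L) (at x) \<Longrightarrow> fderiv f x = L"
  unfolding fderiv_def by (rule some_equality) (auto dest: has_derivative_unique)

lemma
  assumes "holo_fun U f" "x \<in> U"
  shows holo_fun_has_derivative: "(f has_derivative fderiv f x) (at x)"
    and holo_fun_fderiv_cscale: "fderiv f x (cscale c v) = c * fderiv f x v"
  using assms fderiv_eq[of f _ x] unfolding holo_fun_def by metis+

lemma holo_vec_has_derivative:
  assumes "holo_vec U f" "x \<in> U"
  shows "(f has_derivative fderiv f x) (at x)"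
  using assms fderiv_eq[of f _ x] unfolding holo_vec_def by metis

text \<open>The constant is explicit so that bounds can be uniform along a sequence of functions.
  The pointwise form avoids \<open>onorm\<close> and \<open>SUP\<close>, which are informative only
  for bounded sets.\<close>

definition bloch_bounded :: "real \<Rightarrow> ('a::chilbert_space \<Rightarrow> complex) \<Rightarrow> bool" where
  "bloch_bounded M f \<longleftrightarrow> 0 \<le> M \<and> holo_fun (ball 0 1) f \<and>
     (\<forall>x\<in>ball 0 1. \<forall>v. (1 - (norm x)\<^sup>2) * cmod (fderiv f x v) \<le> M * norm v)"

lemma one_minus_norm_square_pos: "norm x < 1 \<Longrightarrow> 0 < 1 - (norm x)\<^sup>2"
  by (simp add: power_less_one_iff abs_square_less_1)

lemma bloch_boundedD:
  assumes "bloch_bounded M f" "norm x < 1"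
  shows "(f has_derivative fderiv f x) (at x)"
    and "(1 - (norm x)\<^sup>2) * cmod (fderiv f x v) \<le> M * norm v"
    and "(1 - (norm x)\<^sup>2) * onorm (fderiv f x) \<le> M"
proof -
  show "(f has_derivative fderiv f x) (at x)"
    using assms holo_fun_has_derivative[of "ball 0 1" f x] by (simp add: bloch_bounded_def)
  have *: "(1 - (norm x)\<^sup>2) * cmod (fderiv f x v) \<le> M * norm v" for v
    using assms by (simp add: bloch_bounded_def)
  then show "(1 - (norm x)\<^sup>2) * cmod (fderiv f x v) \<le> M * norm v" .
  have p: "0 < 1 - (norm x)\<^sup>2" by (rule one_minus_norm_square_pos) (rule assms)
  have "onorm (fderiv f x) \<le> M / (1 - (norm x)\<^sup>2)"
    using * p assms(1) by (intro onorm_bound) (simp_all add: field_simps bloch_bounded_def)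
  then show "(1 - (norm x)\<^sup>2) * onorm (fderiv f x) \<le> M"
    using p by (simp add: field_simps)
qed

lemma bloch_iff_bounded: "f \<in> bloch \<longleftrightarrow> (\<exists>M. bloch_bounded M f)"
proof
  assume f: "f \<in> bloch"
  then have h: "holo_fun (ball 0 1) f" by (simp add: bloch_def)
  from f obtain M where M: "\<And>x. norm x < 1 \<Longrightarrow> (1 - (norm x)\<^sup>2) * onorm (fderiv f x) \<le> M"
    unfolding bloch_def bdd_above_def by (force simp: dist_norm)
  have b: "bounded_linear (fderiv f x)" if "norm x < 1" for x
    using has_derivative_bounded_linear[OF holo_fun_has_derivative[OF h, of x]] that by simp
  have "0 \<le> onorm (fderiv f 0)" using b[of 0] by (intro onorm_pos_le) simp
  then have "0 \<le> M" using M[of 0] by simp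
  moreover have "(1 - (norm x)\<^sup>2) * cmod (fderiv f x v) \<le> M * norm v" if "norm x < 1" for x v
  proof -
    have "cmod (fderiv f x v) \<le> onorm (fderiv f x) * norm v" using onorm[OF b[OF that]] .
    then have "(1 - (norm x)\<^sup>2) * cmod (fderiv f x v) \<le> (1 - (norm x)\<^sup>2) * (onorm (fderiv f x) * norm v)"
      using one_minus_norm_square_pos[OF that] by (intro mult_left_mono) auto
    also have "\<dots> \<le> M * norm v"
      using mult_right_mono[OF M[OF that], of "norm v"] by (simp add: mult.assoc)
    finally show ?thesis .
  qed
  ultimately show "\<exists>M. bloch_bounded M f" using h by (auto simp: bloch_bounded_def)
next
  assume "\<exists>M. bloch_bounded M f"
  then obtain M where M: "bloch_bounded M f" by blast
  then show "f \<in> bloch"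
    using bloch_boundedD(3)[OF M]
    by (auto simp: bloch_def bloch_bounded_def intro!: bdd_aboveI2[of _ _ M])
qed

lemma bloch_diff:
  assumes "f \<in> bloch" "g \<in> bloch"
  shows "(\<lambda>z. f z - g z) \<in> bloch"
    and "\<And>x v. norm x < 1 \<Longrightarrow> fderiv (\<lambda>z. f z - g z) x v = fderiv f x v - fderiv g x v"
proof -
  obtain M N where M: "bloch_bounded M f" and N: "bloch_bounded N g"
    using assms by (auto simp: bloch_iff_bounded)
  have d: "((\<lambda>z. f z - g z) has_derivative (\<lambda>v. fderiv f x v - fderiv g x v)) (at x)"
    if "norm x < 1" for x
    by (intro has_derivative_diff bloch_boundedD(1)[OF M] bloch_boundedD(1)[OF N] that)
  show e: "fderiv (\<lambda>z. f z - g z) x v = fderiv f x v - fderiv g x v" if "norm x < 1" for x v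
    by (simp add: fderiv_eq[OF d[OF that]])
  have "bloch_bounded (M + N) (\<lambda>z. f z - g z)"
    unfolding bloch_bounded_def holo_fun_def
  proof (intro conjI ballI allI)
    show "0 \<le> M + N" using M N by (simp add: bloch_bounded_def)
    fix x :: 'a assume x: "x \<in> ball 0 1"
    then show "\<exists>L. ((\<lambda>z. f z - g z) has_derivative L) (at x) \<and> (\<forall>c v. L (cscale c v) = c * L v)"
      using d[of x] M N
      by (intro exI[of _ "\<lambda>v. fderiv f x v - fderiv g x v"])
        (simp add: bloch_bounded_def right_diff_distrib holo_fun_fderiv_cscale[of "ball 0 1" _ x])
    fix v
    have x1: "norm x < 1" using x by simp
    have "cmod (fderiv (\<lambda>z. f z - g z) x v) \<le> cmod (fderiv f x v) + cmod (fderiv g x v)"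
      by (simp add: e x1 norm_triangle_ineq4)
    then have "(1 - (norm x)\<^sup>2) * cmod (fderiv (\<lambda>z. f z - g z) x v)
        \<le> (1 - (norm x)\<^sup>2) * (cmod (fderiv f x v) + cmod (fderiv g x v))"
      using one_minus_norm_square_pos[OF x1] by (intro mult_left_mono) auto
    then show "(1 - (norm x)\<^sup>2) * cmod (fderiv (\<lambda>z. f z - g z) x v) \<le> (M + N) * norm v"
      using bloch_boundedD(2)[OF M x1, of v] bloch_boundedD(2)[OF N x1, of v]
      by (simp add: algebra_simps)
  qed
  then show "(\<lambda>z. f z - g z) \<in> bloch"
    by (auto simp: bloch_iff_bounded)
qed

text \<open>Mean value inequality on the closed ball of radius \<open>sqrt (1 - e)\<close>, where
  the weight is at least \<open>e\<close>. The hypotheses concern squared norms because Pythagoras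
  supplies them in that form in the tangential estimate.\<close>

lemma bloch_bounded_lipschitz:
  assumes f: "bloch_bounded M f" and e: "0 < e"
    and x: "(norm x)\<^sup>2 \<le> 1 - e" and y: "(norm y)\<^sup>2 \<le> 1 - e"
  shows "cmod (f x - f y) \<le> M / e * norm (x - y)"
proof -
  define S :: "'a set" where "S = cball 0 (sqrt (1 - e))"
  have sq: "(norm w)\<^sup>2 \<le> 1 - e" "norm w < 1" if "w \<in> S" for w
  proof -
    have "norm w \<le> sqrt (1 - e)" using that by (simp add: S_def)
    then have "(norm w)\<^sup>2 \<le> (sqrt (1 - e))\<^sup>2" by (intro power_mono) auto
    moreover have "0 \<le> 1 - e" using x zero_le_power2[of "norm x"] by linarith
    ultimately show *: "(norm w)\<^sup>2 \<le> 1 - e" by simp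
    show "norm w < 1" by (rule power2_less_imp_less) (use * e in auto)
  qed
  have "cmod (f x - f y) \<le> M / e * norm (x - y)"
  proof (rule differentiable_bound[of S f "fderiv f"])
    show "convex S" by (simp add: S_def)
    show "x \<in> S" "y \<in> S" using x y by (simp_all add: S_def real_le_rsqrt)
    fix w assume w: "w \<in> S"
    show "(f has_derivative fderiv f w) (at w within S)"
      using bloch_boundedD(1)[OF f sq(2)[OF w]] by (rule has_derivative_at_withinI)
    have "e * onorm (fderiv f w) \<le> (1 - (norm w)\<^sup>2) * onorm (fderiv f w)"
      using sq(1)[OF w] onorm_pos_le[OF has_derivative_bounded_linear[OF bloch_boundedD(1)[OF f sq(2)[OF w]]]]
      by (intro mult_right_mono) auto
    also have "\<dots> \<le> M" by (rule bloch_boundedD(3)[OF f sq(2)[OF w]])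
    finally show "onorm (fderiv f w) \<le> M / e" using e by (simp add: field_simps)
  qed
  then show ?thesis .
qed

section \<open>Growth of Bloch derivatives in tangential directions\<close>

text \<open>Complex linearity of the derivative makes the restriction to a complex line a
  holomorphic function of one variable, to which Cauchy's inequality applies.\<close>

lemma holo_fun_line_has_field_derivative:
  assumes "holo_fun U f" "x + cscale z v \<in> U"
  shows "((\<lambda>z. f (x + cscale z v)) has_field_derivative fderiv f (x + cscale z v) v) (at z)"
proof -
  have "((\<lambda>z. x + cscale z v) has_derivative (\<lambda>h. 0 + cscale h v)) (at z)"
    by (intro derivative_intros bounded_linear.has_derivative[OF
          bounded_bilinear.bounded_linear_left[OF bounded_bilinear_cscale]])
  from has_derivative_compose[OF this holo_fun_has_derivative[OF assms]]
  show ?thesis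
    by (simp add: has_field_derivative_def holo_fun_fderiv_cscale[OF assms] mult.commute[of _ "fderiv _ _ _"])
qed

text \<open>Base case of the induction towards the origin. Since \<open>1 - norm x\<close> is at
  least 1/4, its square root is at most twice itself and the plain Bloch bound suffices. It yields
  \<open>2 * M\<close>; the constant \<open>8 * M\<close> is the one that the induction
  reproduces.\<close>

lemma bloch_tangential_near_origin:
  assumes f: "bloch_bounded M f" and v: "norm v \<le> 1" and x: "norm x \<le> 3/4"
  shows "cmod (fderiv f x v) * sqrt (1 - norm x) \<le> 8 * M"
proof -
  let ?t = "1 - norm x"
  have M: "0 \<le> M" using f by (simp add: bloch_bounded_def)
  have "1/2 \<le> sqrt ?t" by (rule real_le_rsqrt) (use x in \<open>simp add: power2_eq_square\<close>)
  then have "sqrt ?t \<le> 2 * (sqrt ?t * sqrt ?t)"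
    using mult_right_mono[of "1/2" "sqrt ?t" "sqrt ?t"] x by simp
  also have "\<dots> = 2 * (1 - norm x)" using x by simp
  also have "\<dots> \<le> 2 * (1 - (norm x)\<^sup>2)"
    using mult_left_le[of "norm x" "norm x"] x by (simp add: power2_eq_square)
  finally have "cmod (fderiv f x v) * sqrt ?t \<le> 2 * ((1 - (norm x)\<^sup>2) * cmod (fderiv f x v))"
    using mult_left_mono[of "sqrt ?t" "2 * (1 - (norm x)\<^sup>2)" "cmod (fderiv f x v)"]
    by (simp add: algebra_simps)
  also have "\<dots> \<le> 2 * (M * norm v)" using bloch_boundedD(2)[OF f, of x v] x by simp
  also have "\<dots> \<le> 8 * M" using mult_left_mono[OF v M] M by simp
  finally show ?thesis .
qed

text \<open>Moving \<open>x\<close> towards the origin until its distance to the sphere is multiplied by four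
  changes \<open>f\<close> by a bounded amount on a disc of radius \<open>\<rho>\<close> in the tangential direction \<open>v\<close>, so
  Cauchy's inequality compares the two tangential derivatives.\<close>
lemma bloch_tangential_step:
  fixes f :: "'a::chilbert_space \<Rightarrow> complex"
  assumes f: "bloch_bounded M f" and v: "norm v \<le> 1" and vx: "cinner v x = 0"
    and x: "3/4 < norm x" "norm x < 1"
  obtains x' where "cinner v x' = 0" "norm x' < 1" "1 - norm x' = 4 * (1 - norm x)"
    "cmod (fderiv f x v - fderiv f x' v) * sqrt (1 - norm x) \<le> 4 * M"
proof -
  define t where "t = 1 - norm x"
  \<comment> \<open>This factor puts \<open>x'\<close> on the ray of \<open>x\<close> at norm
    \<open>1 - 4 * t\<close>.\<close>
  define c where "c = (1 - 4 * t) / (1 - t)"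
  define x' where "x' = c *\<^sub>R x"
  \<comment> \<open>A tangential disc can have radius of order \<open>sqrt t\<close>: by Pythagoras
    it adds at most \<open>4/9 * t\<close> to \<open>(1 - t)\<^sup>2\<close>, and as
    \<open>t < 1/4\<close> the squared norm stays at most \<open>1 - 5/4 * t\<close>.\<close>
  define \<rho> where "\<rho> = 2/3 * sqrt t"
  have t: "0 < t" "t < 1/4" "norm x = 1 - t" using x by (auto simp: t_def)
  have c: "0 \<le> c" "c \<le> 1" "c * (1 - t) = 1 - 4 * t" using t by (auto simp: c_def field_simps)
  have nx': "norm x' = 1 - 4 * t" using c t by (simp add: x'_def)
  have vx': "cinner v x' = 0" using vx by (simp add: x'_def cinner_scaleR_right)
  have \<rho>: "0 < \<rho>" "\<rho>\<^sup>2 = 4/9 * t" using t by (simp_all add: \<rho>_def power_mult_distrib power2_eq_square)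
  have M: "0 \<le> M" using f by (simp add: bloch_bounded_def)
  have h: "holo_fun (ball 0 1) f" using f by (simp add: bloch_bounded_def)
  have near: "(norm (y + cscale z v))\<^sup>2 \<le> 1 - 5/4 * t"
    if "cmod z \<le> \<rho>" "cinner v y = 0" "norm y \<le> 1 - t" for y z
  proof -
    have "cinner y (cscale z v) = 0"
      using that(2) cinner_commute[of y v] by (simp add: cinner_cscale_right)
    then have "(norm (y + cscale z v))\<^sup>2 = (norm y)\<^sup>2 + (norm (cscale z v))\<^sup>2"
      by (rule norm_add_orthogonal)
    also have "(norm y)\<^sup>2 \<le> (1 - t)\<^sup>2" using that(3) by (rule power_mono) simp
    also have "norm (cscale z v) \<le> \<rho> * 1"
      unfolding norm_cscale using that(1) v \<rho> by (intro mult_mono) auto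
    then have "(norm (cscale z v))\<^sup>2 \<le> \<rho>\<^sup>2" by (simp add: power_mono)
    also have "(1 - t)\<^sup>2 + \<rho>\<^sup>2 \<le> 1 - 5/4 * t"
      using mult_left_mono[of t "1/4" t] t unfolding \<rho>(2) by (simp add: power2_eq_square algebra_simps)
    finally show ?thesis by simp
  qed
  have near1: "y + cscale z v \<in> ball 0 1"
    if "cmod z \<le> \<rho>" "cinner v y = 0" "norm y \<le> 1 - t" for y z
  proof -
    have "norm (y + cscale z v) < 1"
      by (rule power2_less_imp_less) (use near[OF that] t in auto)
    then show ?thesis by simp
  qed
  have nx: "norm x \<le> 1 - t" "norm x' \<le> 1 - t" using nx' t by auto
  define g where "g = (\<lambda>z. f (x + cscale z v) - f (x' + cscale z v))"
  have dg: "(g has_field_derivative fderiv f (x + cscale z v) v - fderiv f (x' + cscale z v) v) (at z)"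
    if "cmod z \<le> \<rho>" for z
    unfolding g_def
    by (intro DERIV_diff holo_fun_line_has_field_derivative[OF h] near1 that vx vx' nx)
  \<comment> \<open>The two discs are translates of each other at distance \<open>3 * t\<close>, and
    the Lipschitz constant is \<open>M / (5/4 * t)\<close>, so \<open>t\<close> cancels.\<close>
  have bg: "cmod (g z) \<le> 12/5 * M" if "cmod z \<le> \<rho>" for z
  proof -
    have "cmod (g z) \<le> M / (5/4 * t) * norm ((x + cscale z v) - (x' + cscale z v))"
      unfolding g_def using t
      by (intro bloch_bounded_lipschitz[OF f] near that vx vx' nx) auto
    also have "(x + cscale z v) - (x' + cscale z v) = (1 - c) *\<^sub>R x"
      by (simp add: x'_def algebra_simps)
    also have "norm \<dots> = (1 - c) * (1 - t)" using c t by simp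
    also have "\<dots> = 3 * t" using c(3) by (simp add: algebra_simps)
    finally show ?thesis using t by (simp add: field_simps)
  qed
  have "cmod ((deriv ^^ 1) g 0) \<le> fact 1 * (12/5 * M) / \<rho> ^ 1"
  proof (rule Cauchy_inequality)
    show "g holomorphic_on ball 0 \<rho>"
      by (rule holomorphic_onI, rule field_differentiable_at_within)
        (use dg in \<open>force simp: field_differentiable_def\<close>)
    show "continuous_on (cball 0 \<rho>) g"
      by (intro continuous_at_imp_continuous_on ballI)
        (use dg in \<open>force intro: DERIV_isCont\<close>)
  qed (use \<rho> bg in auto)
  moreover have "deriv g 0 = fderiv f x v - fderiv f x' v"
    using DERIV_imp_deriv[OF dg[of 0]] \<rho> by simp
  ultimately have "cmod (fderiv f x v - fderiv f x' v) * \<rho> \<le> 12/5 * M"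
    using \<rho> by (simp add: field_simps)
  \<comment> \<open>Dividing by the factor 2/3 in \<open>\<rho>\<close> gives
    \<open>18/5 * M\<close>, rounded up to \<open>4 * M\<close>.\<close>
  then have "cmod (fderiv f x v - fderiv f x' v) * sqrt t \<le> 4 * M"
    using M by (simp add: \<rho>_def mult.commute)
  then show thesis
    using t(1) by (intro that[of x'] vx') (simp_all add: t(3) nx')
qed

text \<open>Induction on the number of quadruplings of \<open>1 - norm x\<close> that bring
  \<open>x\<close> within norm 3/4. Each one doubles the square root, so the bound
  \<open>8 * M\<close> at \<open>x'\<close> counts only \<open>4 * M\<close> at \<open>x\<close>.
  Together with \<open>4 * M\<close> for the change of the derivative this is \<open>8 * M\<close>
  again, and no error accumulates.\<close>

lemma bloch_tangential_unit:
  assumes f: "bloch_bounded M f" and v: "norm v \<le> 1"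
    and "cinner v x = 0" "norm x < 1"
  shows "cmod (fderiv f x v) * sqrt (1 - norm x) \<le> 8 * M"
proof -
  have "cmod (fderiv f x v) * sqrt (1 - norm x) \<le> 8 * M"
    if "1 \<le> 4 ^ Suc n * (1 - norm x)" "cinner v x = 0" "norm x < 1" for n x
    using that
  proof (induction n arbitrary: x)
    case 0
    then show ?case by (intro bloch_tangential_near_origin[OF f v]) simp
  next
    case (Suc n)
    show ?case
    proof (cases "norm x \<le> 3/4")
      case True
      then show ?thesis by (rule bloch_tangential_near_origin[OF f v])
    next
      case False
      then obtain x' where x': "cinner v x' = 0" "norm x' < 1" "1 - norm x' = 4 * (1 - norm x)"
        and d: "cmod (fderiv f x v - fderiv f x' v) * sqrt (1 - norm x) \<le> 4 * M"
        using bloch_tangential_step[OF f v, of x] Suc.prems by auto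
      have "cmod (fderiv f x' v) * sqrt (1 - norm x') \<le> 8 * M"
        by (rule Suc.IH, unfold x'(3)) (use Suc.prems x'(1,2) in \<open>simp_all add: algebra_simps\<close>)
      then have "cmod (fderiv f x' v) * sqrt (1 - norm x) \<le> 4 * M"
        unfolding x'(3) real_sqrt_mult by (simp add: mult.commute)
      moreover have "cmod (fderiv f x v) \<le> cmod (fderiv f x v - fderiv f x' v) + cmod (fderiv f x' v)"
        using norm_triangle_ineq[of "fderiv f x v - fderiv f x' v" "fderiv f x' v"] by simp
      then have "cmod (fderiv f x v) * sqrt (1 - norm x)
          \<le> (cmod (fderiv f x v - fderiv f x' v) + cmod (fderiv f x' v)) * sqrt (1 - norm x)"
        using Suc.prems by (intro mult_right_mono) auto
      ultimately show ?thesis using d by (simp add: distrib_right)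
    qed
  qed
  moreover obtain n where "1 / (1 - norm x) < 4 ^ n" using real_arch_pow[of 4] by auto
  then have "1 \<le> 4 ^ n * (1 - norm x)" using assms(4) by (simp add: field_simps)
  moreover have "\<dots> \<le> 4 ^ Suc n * (1 - norm x)" using assms(4) by simp
  ultimately show ?thesis using assms by (meson order_trans)
qed

lemma bloch_tangential:
  assumes f: "bloch_bounded M f" and vx: "cinner v x = 0" and x: "norm x < 1"
  shows "sqrt (1 - (norm x)\<^sup>2) * cmod (fderiv f x v) \<le> 12 * M * norm v"
proof (cases "v = 0")
  case True
  then show ?thesis
    using linear_0[OF bounded_linear.linear[OF has_derivative_bounded_linear[OF bloch_boundedD(1)[OF f x]]]]
    by simp
next
  case False
  define u where "u = (1 / norm v) *\<^sub>R v"
  have v: "v = norm v *\<^sub>R u" using False by (simp add: u_def)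
  interpret D: bounded_linear "fderiv f x"
    by (rule has_derivative_bounded_linear[OF bloch_boundedD(1)[OF f x]])
  have u: "cmod (fderiv f x u) * sqrt (1 - norm x) \<le> 8 * M"
    by (rule bloch_tangential_unit[OF f]) (use vx x False in \<open>auto simp: u_def cinner_scaleR_left\<close>)
  \<comment> \<open>The number 9/4 exceeds \<open>1 + norm x\<close> and has the rational root 3/2,
    which turns 8 into 12.\<close>
  have "1 - (norm x)\<^sup>2 \<le> (3/2)\<^sup>2 * (1 - norm x)"
    using mult_right_mono[of "1 + norm x" "9/4" "1 - norm x"] x
    by (simp add: power2_eq_square algebra_simps)
  then have "sqrt (1 - (norm x)\<^sup>2) \<le> sqrt ((3/2)\<^sup>2 * (1 - norm x))" by (simp only: real_sqrt_le_iff)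
  also have "\<dots> = 3/2 * sqrt (1 - norm x)" by (simp add: real_sqrt_mult)
  finally have "sqrt (1 - (norm x)\<^sup>2) * cmod (fderiv f x u) \<le> 3/2 * (cmod (fderiv f x u) * sqrt (1 - norm x))"
    using mult_right_mono[of "sqrt (1 - (norm x)\<^sup>2)" "3/2 * sqrt (1 - norm x)" "cmod (fderiv f x u)"]
    by (simp add: mult_ac)
  also have "\<dots> \<le> 12 * M" using u by linarith
  finally have "norm v * (sqrt (1 - (norm x)\<^sup>2) * cmod (fderiv f x u)) \<le> norm v * (12 * M)"
    by (rule mult_left_mono) simp
  moreover have "cmod (fderiv f x v) = norm v * cmod (fderiv f x u)"
    by (subst v) (simp add: D.scaleR)
  ultimately show ?thesis by (simp add: mult_ac)
qed

section \<open>The two Bloch seminorms are equivalent\<close>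

lemma fderiv_comp_mobius_0:
  assumes f: "bloch_bounded M f" and x: "norm x < 1"
  shows "bounded_linear (fderiv (f \<circ> mobius x) 0)"
    and "fderiv (f \<circ> mobius x) 0 v =
      - fderiv f x (sqrt (1 - (norm x)\<^sup>2) *\<^sub>R projQ x v + (1 - (norm x)\<^sup>2) *\<^sub>R projP x v)"
proof -
  have f': "(f has_derivative fderiv f x) (at (mobius x 0))"
    using bloch_boundedD(1)[OF f x] by simp
  interpret D: bounded_linear "fderiv f x" by (rule has_derivative_bounded_linear[OF f'])
  have d: "((f \<circ> mobius x) has_derivative (\<lambda>v. fderiv f x
      (- (sqrt (1 - (norm x)\<^sup>2) *\<^sub>R projQ x v + (1 - (norm x)\<^sup>2) *\<^sub>R projP x v)))) (at 0)"
    using has_derivative_compose[OF mobius_has_derivative_0[OF x] f'] by (simp add: comp_def)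
  from has_derivative_bounded_linear[OF d] show "bounded_linear (fderiv (f \<circ> mobius x) 0)"
    by (simp add: fderiv_eq[OF d])
  show "fderiv (f \<circ> mobius x) 0 v =
      - fderiv f x (sqrt (1 - (norm x)\<^sup>2) *\<^sub>R projQ x v + (1 - (norm x)\<^sup>2) *\<^sub>R projP x v)"
    unfolding fderiv_eq[OF d] D.neg ..
qed

text \<open>The tangential part of \<open>v\<close> carries the square root weight and costs
  \<open>12 * M\<close> by \<open>bloch_tangential\<close>; the radial part carries the full weight
  and costs \<open>M\<close>. Hence the supremum in \<open>bloch_norm\<close> is finite.\<close>

lemma onorm_comp_mobius_le:
  assumes f: "bloch_bounded M f" and x: "norm x < 1"
  shows "onorm (fderiv (f \<circ> mobius x) 0) \<le> 13 * M"
proof (rule onorm_bound)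
  show M: "0 \<le> 13 * M" using f by (simp add: bloch_bounded_def)
  fix v
  let ?s = "sqrt (1 - (norm x)\<^sup>2)"
  interpret D: bounded_linear "fderiv f x"
    by (rule has_derivative_bounded_linear[OF bloch_boundedD(1)[OF f x]])
  have p: "0 < 1 - (norm x)\<^sup>2" by (rule one_minus_norm_square_pos) (rule x)
  have "cmod (fderiv (f \<circ> mobius x) 0 v)
      = cmod (fderiv f x (?s *\<^sub>R projQ x v) + fderiv f x ((1 - (norm x)\<^sup>2) *\<^sub>R projP x v))"
    unfolding fderiv_comp_mobius_0[OF f x] D.add norm_minus_cancel ..
  also have "\<dots> \<le> ?s * cmod (fderiv f x (projQ x v)) + (1 - (norm x)\<^sup>2) * cmod (fderiv f x (projP x v))"
    using p by (intro norm_triangle_le) (simp add: D.scaleR)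
  also have "\<dots> \<le> 12 * M * norm (projQ x v) + M * norm (projP x v)"
    by (intro add_mono bloch_tangential[OF f] bloch_boundedD(2)[OF f] x) simp
  also have "\<dots> \<le> 12 * M * norm v + M * norm v"
    using M by (intro add_mono mult_left_mono norm_projQ_le norm_projP_le) auto
  finally show "cmod (fderiv (f \<circ> mobius x) 0 v) \<le> 13 * M * norm v" by (simp add: algebra_simps)
qed

lemma bloch_norm_le:
  assumes "bloch_bounded M f"
  shows "bloch_norm f \<le> cmod (f 0) + 13 * M"
  unfolding bloch_norm_def
  by (intro add_left_mono cSUP_least) (auto simp: onorm_comp_mobius_le[OF assms])

text \<open>Once the supremum is known to be finite, it dominates each of its terms. The derivative
  bound follows by inverting the derivative of the Moebius map at 0 up to the factor
  \<open>1 - (norm x)\<^sup>2\<close>.\<close>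

lemma
  assumes "f \<in> bloch"
  shows bloch_norm_ge_0: "cmod (f 0) \<le> bloch_norm f"
    and bloch_norm_ge_fderiv:
      "norm x < 1 \<Longrightarrow> (1 - (norm x)\<^sup>2) * cmod (fderiv f x w) \<le> 2 * bloch_norm f * norm w"
proof -
  obtain M where f: "bloch_bounded M f" using assms by (auto simp: bloch_iff_bounded)
  define S where "S = (SUP x\<in>ball 0 1. onorm (fderiv (f \<circ> mobius x) 0))"
  have S: "onorm (fderiv (f \<circ> mobius x) 0) \<le> S" if "norm x < 1" for x
    unfolding S_def using that
    by (intro cSUP_upper bdd_aboveI2[of _ _ "13 * M"]) (auto simp: onorm_comp_mobius_le[OF f])
  have S0: "0 \<le> S"
    using S[of 0] onorm_pos_le[OF fderiv_comp_mobius_0(1)[OF f, of 0]] by simp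
  show "cmod (f 0) \<le> bloch_norm f" using S0 by (simp add: bloch_norm_def S_def)
  assume x: "norm x < 1"
  let ?s = "sqrt (1 - (norm x)\<^sup>2)"
  have p: "0 < 1 - (norm x)\<^sup>2" by (rule one_minus_norm_square_pos) (rule x)
  \<comment> \<open>Chosen so that the derivative of \<open>mobius x\<close> at 0 sends
    \<open>v\<close> to \<open>w\<close> times the negative of
    \<open>1 - (norm x)\<^sup>2\<close>.\<close>
  define v where "v = ?s *\<^sub>R projQ x w + projP x w"
  interpret P: bounded_linear "projP x" by (rule bounded_linear_projP)
  interpret D: bounded_linear "fderiv f x"
    by (rule has_derivative_bounded_linear[OF bloch_boundedD(1)[OF f x]])
  have "projP x (projQ x w) = 0" using projQ_cinner[of x w] by (simp add: projP_def)
  moreover have "projP x (projP x w) = projP x w"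
    by (simp add: projP_def cinner_cscale_left cinner_self)
  ultimately have Pv: "projP x v = projP x w" "projQ x v = ?s *\<^sub>R projQ x w"
    by (simp_all add: v_def projQ_def P.add P.scaleR P.diff)
  have "?s *\<^sub>R projQ x v + (1 - (norm x)\<^sup>2) *\<^sub>R projP x v = (1 - (norm x)\<^sup>2) *\<^sub>R (projQ x w + projP x w)"
    using p by (simp add: Pv scaleR_add_right)
  also have "projQ x w + projP x w = w" by (simp add: projQ_def)
  finally have "cmod (fderiv (f \<circ> mobius x) 0 v) = (1 - (norm x)\<^sup>2) * cmod (fderiv f x w)"
    using p by (simp add: fderiv_comp_mobius_0[OF f x] D.scaleR)
  then have "(1 - (norm x)\<^sup>2) * cmod (fderiv f x w) \<le> onorm (fderiv (f \<circ> mobius x) 0) * norm v"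
    using onorm[OF fderiv_comp_mobius_0(1)[OF f x], of v] by simp
  also have "\<dots> \<le> bloch_norm f * norm v"
    using S[OF x] unfolding bloch_norm_def S_def[symmetric]
    by (intro mult_right_mono) (auto intro: add_increasing)
  also have "norm v \<le> 2 * norm w"
  proof -
    have "?s * norm (projQ x w) \<le> 1 * norm w"
      by (intro mult_mono norm_projQ_le) (use p in auto)
    then have "norm (?s *\<^sub>R projQ x w) + norm (projP x w) \<le> 2 * norm w"
      using norm_projP_le[of x w] p by simp
    then show ?thesis unfolding v_def by (rule norm_triangle_le)
  qed
  then have "bloch_norm f * norm v \<le> bloch_norm f * (2 * norm w)"
    using S0 by (intro mult_left_mono) (auto simp: bloch_norm_def S_def)
  finally show "(1 - (norm x)\<^sup>2) * cmod (fderiv f x w) \<le> 2 * bloch_norm f * norm w" by simp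
qed

lemma bloch_bounded_bloch_norm: "f \<in> bloch \<Longrightarrow> bloch_bounded (2 * bloch_norm f) f"
  using order_trans[OF norm_ge_zero bloch_norm_ge_0[of f]] bloch_norm_ge_fderiv[of f]
  by (simp add: bloch_bounded_def) (simp add: bloch_def)

section \<open>Test functions\<close>

lemma bloch_boundedI:
  assumes "0 \<le> M"
    and d: "\<And>x. norm x < 1 \<Longrightarrow> (f has_derivative L x) (at x)"
    and "\<And>x c v. norm x < 1 \<Longrightarrow> L x (cscale c v) = c * L x v"
    and "\<And>x v. norm x < 1 \<Longrightarrow> (1 - (norm x)\<^sup>2) * cmod (L x v) \<le> M * norm v"
  shows "bloch_bounded M f"
  unfolding bloch_bounded_def holo_fun_def
proof (intro conjI ballI allI)
  fix x v :: 'a assume "x \<in> ball 0 1"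
  then have x: "norm x < 1" by simp
  show "\<exists>L. (f has_derivative L) (at x) \<and> (\<forall>c v. L (cscale c v) = c * L v)"
    using assms(2,3)[OF x] by blast
  show "(1 - (norm x)\<^sup>2) * cmod (fderiv f x v) \<le> M * norm v"
    unfolding fderiv_eq[OF d[OF x]] by (rule assms(4)[OF x])
qed (rule assms(1))

definition linear_test :: "'a::chilbert_space \<Rightarrow> 'a \<Rightarrow> complex" where
  "linear_test u y = cinner y u"

text \<open>The Drury-Arveson kernel at \<open>a\<close>, scaled so that its Bloch size stays
  bounded as \<open>a\<close> approaches the sphere.\<close>

definition radial_test :: "'a::chilbert_space \<Rightarrow> 'a \<Rightarrow> complex" where
  "radial_test a y = of_real (1 - (norm a)\<^sup>2) / (1 - cinner y a)"

text \<open>Only a square root scales the kernel here. When \<open>u\<close> has norm at most 1 and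
  is orthogonal to \<open>a\<close>, the factor \<open>cinner y u\<close> is at most of the order of
  the square root of the denominator and supplies the other half power.\<close>

definition tangential_test :: "'a::chilbert_space \<Rightarrow> 'a \<Rightarrow> 'a \<Rightarrow> complex" where
  "tangential_test a u y = of_real (sqrt (1 - (norm a)\<^sup>2)) * cinner y u / (1 - cinner y a)"

lemma bloch_bounded_linear_test:
  assumes "norm u \<le> 1"
  shows "bloch_bounded 1 (linear_test u)"
proof (rule bloch_boundedI[where L = "\<lambda>_ v. cinner v u"])
  fix x v :: 'a assume x: "norm x < 1"
  show "(linear_test u has_derivative (\<lambda>v. cinner v u)) (at x)"
    unfolding linear_test_def[abs_def]
    by (rule bounded_linear_imp_has_derivative[OF bounded_linear_cinner_left])
  have "(1 - (norm x)\<^sup>2) * cmod (cinner v u) \<le> 1 * (norm v * norm u)"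
    using one_minus_norm_square_pos[OF x] by (intro mult_mono cinner_Cauchy_Schwarz) auto
  also have "\<dots> \<le> 1 * norm v" using assms by (simp add: mult_left_le)
  finally show "(1 - (norm x)\<^sup>2) * cmod (cinner v u) \<le> 1 * norm v" .
qed (simp_all add: cinner_cscale_left)

lemma one_minus_square_le: "0 \<le> t \<Longrightarrow> t \<le> 1 \<Longrightarrow> 1 - t\<^sup>2 \<le> 2 * (1 - t)" for t :: real
  using zero_le_power2[of "1 - t"] by (simp add: power2_eq_square algebra_simps)

lemma radial_test_has_derivative:
  assumes "norm a < 1" "norm y < 1"
  shows "(radial_test a has_derivative
      (\<lambda>v. of_real (1 - (norm a)\<^sup>2) * cinner v a / (1 - cinner y a)\<^sup>2)) (at y)"
proof -
  have "1 - cinner y a \<noteq> 0" using cinner_near_1(3)[OF assms] by simp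
  then have "((\<lambda>y. of_real (1 - (norm a)\<^sup>2) / (1 - cinner y a)) has_derivative
      (\<lambda>v. (0 * (1 - cinner y a) - of_real (1 - (norm a)\<^sup>2) * (0 - cinner v a)) /
        ((1 - cinner y a) * (1 - cinner y a)))) (at y)"
    by (intro has_derivative_divide' has_derivative_diff has_derivative_const
        has_derivative_cinner_left has_derivative_ident)
  then show ?thesis
    unfolding radial_test_def[abs_def] by (simp add: power2_eq_square)
qed

lemma tangential_test_has_derivative:
  assumes "norm a < 1" "norm y < 1"
  shows "(tangential_test a u has_derivative
      (\<lambda>v. of_real (sqrt (1 - (norm a)\<^sup>2)) *
        (cinner v u / (1 - cinner y a) + cinner y u * cinner v a / (1 - cinner y a)\<^sup>2))) (at y)"
proof -
  have "1 - cinner y a \<noteq> 0" using cinner_near_1(3)[OF assms] by simp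
  then have "((\<lambda>y. of_real (sqrt (1 - (norm a)\<^sup>2)) * (cinner y u / (1 - cinner y a))) has_derivative
      (\<lambda>v. of_real (sqrt (1 - (norm a)\<^sup>2)) * 
        ((cinner v u * (1 - cinner y a) - cinner y u * (0 - cinner v a)) / ((1 - cinner y a) * (1 - cinner y a))))) (at y)"
    by (intro has_derivative_mult_right has_derivative_divide' has_derivative_diff has_derivative_const
        has_derivative_cinner_left has_derivative_ident)
  then show ?thesis
    unfolding tangential_test_def[abs_def] using \<open>1 - cinner y a \<noteq> 0\<close>
    by (simp add: add_divide_distrib power2_eq_square)
qed

text \<open>The weights at \<open>x\<close> and at \<open>a\<close> are each at most twice the
  modulus of \<open>1 - cinner x a\<close>; their product cancels its square and leaves 4.\<close>

lemma bloch_bounded_radial_test: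
  fixes a :: "'a::chilbert_space"
  assumes a: "norm a < 1"
  shows "bloch_bounded 4 (radial_test a)"
proof (rule bloch_boundedI[OF _ radial_test_has_derivative[OF a]])
  fix x v :: 'a assume x: "norm x < 1"
  let ?d = "cmod (1 - cinner x a)"
  note n = cinner_near_1[OF a x]
  have d: "0 < ?d" using n(3) by simp
  have x2: "1 - (norm x)\<^sup>2 \<le> 2 * ?d" and a2: "1 - (norm a)\<^sup>2 \<le> 2 * ?d"
    using n one_minus_square_le[of "norm x"] one_minus_square_le[of "norm a"] x a by auto
  have p: "0 < 1 - (norm x)\<^sup>2" "0 < 1 - (norm a)\<^sup>2" using one_minus_norm_square_pos x a by auto
  have "cmod (cinner v a) \<le> norm v"
    using cinner_Cauchy_Schwarz[of v a] a by (meson mult_left_le norm_ge_zero order_trans less_imp_le)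
  then have "(1 - (norm x)\<^sup>2) * ((1 - (norm a)\<^sup>2) * cmod (cinner v a) / ?d\<^sup>2) \<le> (2 * ?d) * ((2 * ?d) * norm v / ?d\<^sup>2)"
    using x2 a2 p d by (intro mult_mono divide_right_mono) auto
  moreover have "cmod (of_real (1 - (norm a)\<^sup>2) * cinner v a / (1 - cinner x a)\<^sup>2)
      = (1 - (norm a)\<^sup>2) * cmod (cinner v a) / ?d\<^sup>2"
    using p by (simp add: norm_mult norm_divide norm_power del: of_real_diff)
  ultimately show "(1 - (norm x)\<^sup>2) * cmod (of_real (1 - (norm a)\<^sup>2) * cinner v a / (1 - cinner x a)\<^sup>2) \<le> 4 * norm v"
    using d by (simp add: power2_eq_square)
qed (simp_all add: cinner_cscale_left)

text \<open>With \<open>d\<close> the modulus of \<open>1 - cinner x a\<close>, the two summands of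
  the derivative are at most \<open>norm v / d\<close> and \<open>2 * norm v / d\<close>. The weight
  at \<open>x\<close> is at most \<open>2 * d\<close>, whence 6.\<close>

lemma bloch_bounded_tangential_test:
  fixes a :: "'a::chilbert_space"
  assumes a: "norm a < 1" and u: "norm u \<le> 1" "cinner u a = 0"
  shows "bloch_bounded 6 (tangential_test a u)"
proof (rule bloch_boundedI[OF _ tangential_test_has_derivative[OF a]])
  fix x v :: 'a assume x: "norm x < 1"
  let ?d = "cmod (1 - cinner x a)" and ?s = "sqrt (1 - (norm a)\<^sup>2)"
  note n = cinner_near_1[OF a x]
  have d: "0 < ?d" using n(3) by simp
  have x2: "1 - (norm x)\<^sup>2 \<le> 2 * ?d" and a2: "1 - (norm a)\<^sup>2 \<le> 2 * ?d"
    using n one_minus_square_le[of "norm x"] one_minus_square_le[of "norm a"] x a by auto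
  have p: "0 < 1 - (norm x)\<^sup>2" "0 < 1 - (norm a)\<^sup>2" using one_minus_norm_square_pos x a by auto
  have va: "cmod (cinner v a) \<le> norm v"
    using cinner_Cauchy_Schwarz[of v a] a by (meson mult_left_le norm_ge_zero order_trans less_imp_le)
  have vu: "cmod (cinner v u) \<le> norm v"
    using cinner_Cauchy_Schwarz[of v u] u by (meson mult_left_le norm_ge_zero order_trans)
  have "(cmod (cinner x u))\<^sup>2 \<le> (norm x)\<^sup>2 - (cmod (cinner x a))\<^sup>2"
    by (rule cinner_bessel2) (use u a in auto)
  also have "\<dots> \<le> 1 - (cmod (cinner x a))\<^sup>2" using p by simp
  also have "\<dots> \<le> 2 * (1 - cmod (cinner x a))"
    by (rule one_minus_square_le)
      (use cinner_Cauchy_Schwarz[of x a] mult_mono[of "norm x" 1 "norm a" 1] x a in auto)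
  also have "\<dots> \<le> 2 * ?d" using norm_triangle_ineq2[of 1 "cinner x a"] by simp
  finally have "(?s * cmod (cinner x u))\<^sup>2 \<le> (2 * ?d) * (2 * ?d)"
    using a2 p d unfolding power_mult_distrib by (intro mult_mono) auto
  then have su: "?s * cmod (cinner x u) \<le> 2 * ?d"
    by (intro power2_le_imp_le[of "?s * cmod (cinner x u)"]) (auto simp: power2_eq_square)
  have "cmod (of_real ?s * (cinner v u / (1 - cinner x a) + cinner x u * cinner v a / (1 - cinner x a)\<^sup>2))
      \<le> cmod (of_real ?s * (cinner v u / (1 - cinner x a))) + cmod (of_real ?s * (cinner x u * cinner v a / (1 - cinner x a)\<^sup>2))"
    unfolding distrib_left by (rule norm_triangle_ineq)
  also have "cmod (of_real ?s * (cinner v u / (1 - cinner x a))) = ?s * cmod (cinner v u) / ?d"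
    using p by (simp add: norm_mult norm_divide)
  also have "\<dots> \<le> 1 * norm v / ?d"
    using p vu d by (intro divide_right_mono mult_mono) auto
  also have "cmod (of_real ?s * (cinner x u * cinner v a / (1 - cinner x a)\<^sup>2)) = (?s * cmod (cinner x u)) * cmod (cinner v a) / ?d\<^sup>2"
    using p by (simp add: norm_mult norm_divide norm_power)
  also have "\<dots> \<le> (2 * ?d) * norm v / ?d\<^sup>2"
    by (intro divide_right_mono mult_mono[OF su va]) auto
  also have "1 * norm v / ?d + (2 * ?d) * norm v / ?d\<^sup>2 = 3 * norm v / ?d"
    using d by (simp add: field_simps power2_eq_square)
  finally have "(1 - (norm x)\<^sup>2) * cmod (of_real ?s * (cinner v u / (1 - cinner x a) + cinner x u * cinner v a / (1 - cinner x a)\<^sup>2))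
      \<le> (2 * ?d) * (3 * norm v / ?d)"
    using x2 p d by (intro mult_mono) auto
  then show "(1 - (norm x)\<^sup>2) * cmod (of_real ?s * (cinner v u / (1 - cinner x a) + cinner x u * cinner v a / (1 - cinner x a)\<^sup>2)) \<le> 6 * norm v"
    using d by simp
qed (simp_all add: cinner_cscale_left distrib_left mult.left_commute)

text \<open>At \<open>y = a\<close> the denominator is the square of
  \<open>1 - (norm a)\<^sup>2\<close>, and one power survives. For \<open>a = \<phi> z\<close> and
  \<open>v\<close> the radial derivative at \<open>z\<close>, the weight at \<open>z\<close> turns
  the modulus into the quotient of (3).\<close>

lemma fderiv_radial_test_self:
  assumes "norm a < 1"
  shows "fderiv (radial_test a) a v = cinner v a / of_real (1 - (norm a)\<^sup>2)"
proof -
  have "complex_of_real (1 - (norm a)\<^sup>2) \<noteq> 0"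
    using one_minus_norm_square_pos[OF assms] by (simp only: of_real_eq_0_iff)
  moreover have "1 - cinner a a = of_real (1 - (norm a)\<^sup>2)" by (simp add: cinner_self)
  ultimately show ?thesis
    unfolding fderiv_eq[OF radial_test_has_derivative[OF assms assms]] power2_eq_square[of "1 - cinner a a"]
    by (simp del: of_real_diff)
qed

text \<open>Orthogonality of \<open>u\<close> and \<open>a\<close> removes the second summand of the
  derivative at \<open>y = a\<close>; what remains gives the tangential part of the quotient in
  (2).\<close>

lemma fderiv_tangential_test_self:
  assumes "norm a < 1" "cinner u a = 0"
  shows "fderiv (tangential_test a u) a v = cinner v u / of_real (sqrt (1 - (norm a)\<^sup>2))"
proof -
  let ?s = "sqrt (1 - (norm a)\<^sup>2)"
  have s: "0 < ?s" "?s * ?s = 1 - (norm a)\<^sup>2"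
    using one_minus_norm_square_pos[OF assms(1)] by simp_all
  have "1 - cinner a a = of_real (?s * ?s)" unfolding s(2) by (simp add: cinner_self)
  moreover have "cinner a u = 0" using assms(2) cinner_commute[of a u] by simp
  ultimately show ?thesis
    unfolding fderiv_eq[OF tangential_test_has_derivative[OF assms(1,1)]]
    using s(1) by (simp del: real_sqrt_mult_self)
qed

section \<open>Decay of the test derivatives as the parameter approaches the sphere\<close>

lemma tendsto_at_sphere:
  assumes "(\<lambda>n. norm (a n)) \<longlonglongrightarrow> 1"
  shows "(\<lambda>n. 1 - (norm (a n))\<^sup>2) \<longlonglongrightarrow> 0" "(\<lambda>n. sqrt (1 - (norm (a n))\<^sup>2)) \<longlonglongrightarrow> 0"
proof -
  show *: "(\<lambda>n. 1 - (norm (a n))\<^sup>2) \<longlonglongrightarrow> 0"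
    using tendsto_diff[OF tendsto_const tendsto_power[OF assms, of 2], of 1] by simp
  show "(\<lambda>n. sqrt (1 - (norm (a n))\<^sup>2)) \<longlonglongrightarrow> 0"
    using tendsto_real_sqrt[OF *] by simp
qed

lemma cmod_cinner_le:
  assumes "norm a \<le> 1"
  shows "cmod (cinner v a) \<le> norm v"
  using cinner_Cauchy_Schwarz[of v a] mult_left_le[OF assms norm_ge_zero[of v]] by linarith

lemma radial_test_fderiv_tendsto_0:
  assumes a: "\<And>n. norm (a n) < 1" "(\<lambda>n. norm (a n)) \<longlonglongrightarrow> 1" and y: "norm y < 1"
  shows "(\<lambda>n. fderiv (radial_test (a n)) y v) \<longlonglongrightarrow> 0"
proof (rule Lim_null_comparison)
  have "cmod (fderiv (radial_test (a n)) y v) \<le> (1 - (norm (a n))\<^sup>2) * norm v / (1 - norm y)\<^sup>2" for n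
  proof -
    have p: "0 < 1 - (norm (a n))\<^sup>2" using one_minus_norm_square_pos a by auto
    have "cmod (fderiv (radial_test (a n)) y v)
        = (1 - (norm (a n))\<^sup>2) * cmod (cinner v (a n)) / (cmod (1 - cinner y (a n)))\<^sup>2"
      unfolding fderiv_eq[OF radial_test_has_derivative[OF a(1) y]]
      using p by (simp add: norm_mult norm_divide norm_power del: of_real_diff)
    also have "\<dots> \<le> (1 - (norm (a n))\<^sup>2) * norm v / (1 - norm y)\<^sup>2"
      using p y cinner_near_1[OF a(1) y]
      by (intro frac_le mult_mono power_mono cmod_cinner_le less_imp_le[OF a(1)]) auto
    finally show ?thesis .
  qed
  then show "\<forall>\<^sub>F n in sequentially. cmod (fderiv (radial_test (a n)) y v) \<le> (1 - (norm (a n))\<^sup>2) * norm v / (1 - norm y)\<^sup>2"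
    by simp
  show "(\<lambda>n. (1 - (norm (a n))\<^sup>2) * norm v / (1 - norm y)\<^sup>2) \<longlonglongrightarrow> 0"
    using tendsto_mult_left_zero[OF tendsto_at_sphere(1)[OF a(2)], of "norm v / (1 - norm y)\<^sup>2"] by simp
qed

lemma tangential_test_fderiv_tendsto_0:
  assumes a: "\<And>n. norm (a n) < 1" "(\<lambda>n. norm (a n)) \<longlonglongrightarrow> 1"
    and u: "\<And>n. norm (u n) \<le> 1" and y: "norm y < 1"
  shows "(\<lambda>n. fderiv (tangential_test (a n) (u n)) y v) \<longlonglongrightarrow> 0"
proof (rule Lim_null_comparison)
  let ?C = "norm v / (1 - norm y) + 1 * norm v / (1 - norm y)\<^sup>2"
  have "cmod (fderiv (tangential_test (a n) (u n)) y v) \<le> sqrt (1 - (norm (a n))\<^sup>2) * ?C" for n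
  proof -
    have p: "0 < 1 - (norm (a n))\<^sup>2" using one_minus_norm_square_pos a by auto
    note n = cinner_near_1[OF a(1)[of n] y]
    have "cmod (cinner v (u n)) / cmod (1 - cinner y (a n)) \<le> norm v / (1 - norm y)"
      using n y by (intro frac_le cmod_cinner_le u) auto
    moreover have "cmod (cinner y (u n)) * cmod (cinner v (a n)) / (cmod (1 - cinner y (a n)))\<^sup>2 \<le> 1 * norm v / (1 - norm y)\<^sup>2"
      using n y cmod_cinner_le[OF u, of y n]
      by (intro frac_le mult_mono power_mono cmod_cinner_le less_imp_le[OF a(1)]) auto
    ultimately have "cmod (cinner v (u n) / (1 - cinner y (a n)) + cinner y (u n) * cinner v (a n) / (1 - cinner y (a n))\<^sup>2) \<le> ?C"
      by (intro norm_triangle_le) (simp add: norm_mult norm_divide norm_power)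
    then have "sqrt (1 - (norm (a n))\<^sup>2) * cmod (cinner v (u n) / (1 - cinner y (a n)) + cinner y (u n) * cinner v (a n) / (1 - cinner y (a n))\<^sup>2)
        \<le> sqrt (1 - (norm (a n))\<^sup>2) * ?C"
      using p by (intro mult_left_mono) auto
    then show ?thesis
      unfolding fderiv_eq[OF tangential_test_has_derivative[OF a(1) y]] norm_mult[of "of_real _"] norm_of_real
      using p by simp
  qed
  then show "\<forall>\<^sub>F n in sequentially. cmod (fderiv (tangential_test (a n) (u n)) y v) \<le> sqrt (1 - (norm (a n))\<^sup>2) * ?C"
    by simp
  show "(\<lambda>n. sqrt (1 - (norm (a n))\<^sup>2) * ?C) \<longlonglongrightarrow> 0"
    by (rule tendsto_mult_left_zero[OF tendsto_at_sphere(2)[OF a(2)]])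
qed

section \<open>Consequences of compactness\<close>

lemma compact_comp_op_subsequence:
  fixes F :: "nat \<Rightarrow> 'a::chilbert_space \<Rightarrow> complex"
  assumes "compact_comp_op \<phi>" "(\<forall>n. F n \<in> bloch) \<and> (\<exists>M. \<forall>n. bloch_norm (F n) \<le> M)"
  shows "\<exists>(r::nat \<Rightarrow> nat) g. strict_mono r \<and> g \<in> bloch \<and>
           (\<lambda>n. bloch_norm (\<lambda>z. (F (r n) \<circ> \<phi>) z - g z)) \<longlonglongrightarrow> 0"
  using assms(1)[unfolded compact_comp_op_def, THEN conjunct2, rule_format, of F] assms(2) by simp

text \<open>The derivatives of the \<open>F n\<close> tend to zero pointwise, so any Bloch limit of their images
  under the composition operator is constant.\<close>
lemma compact_comp_op_null_sequence:
  fixes \<phi> :: "'a::chilbert_space \<Rightarrow> 'a"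
  assumes holo: "holo_vec (ball 0 1) \<phi>" and self: "\<phi> ` ball 0 1 \<subseteq> ball 0 1"
    and comp: "compact_comp_op \<phi>"
    and F: "\<And>n. bloch_bounded K (F n)" "\<And>n. cmod (F n 0) \<le> C"
    and null: "\<And>y v. norm y < 1 \<Longrightarrow> (\<lambda>n. fderiv (F n) y v) \<longlonglongrightarrow> 0"
    and z: "\<And>n. norm (z n) < 1"
  obtains r :: "nat \<Rightarrow> nat" where "strict_mono r"
    "(\<lambda>n. (1 - (norm (z (r n)))\<^sup>2) * cmod (fderiv (F (r n)) (\<phi> (z (r n))) (radial_deriv \<phi> (z (r n))))) \<longlonglongrightarrow> 0"
proof -
  have Fb: "F n \<in> bloch" for n using F(1) by (auto simp: bloch_iff_bounded)
  have "bloch_norm (F n) \<le> C + 13 * K" for n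
    using bloch_norm_le[OF F(1)[of n]] F(2)[of n] by linarith
  with Fb have "(\<forall>n. F n \<in> bloch) \<and> (\<exists>M. \<forall>n. bloch_norm (F n) \<le> M)" by blast
  from compact_comp_op_subsequence[OF comp this]
  obtain r g where r: "strict_mono (r :: nat \<Rightarrow> nat)" and g: "g \<in> bloch"
    and lim: "(\<lambda>n. bloch_norm (\<lambda>z. (F (r n) \<circ> \<phi>) z - g z)) \<longlonglongrightarrow> 0"
    by blast
  define \<beta> where "\<beta> = (\<lambda>n. bloch_norm (\<lambda>z. (F (r n) \<circ> \<phi>) z - g z))"
  \<comment> \<open>Membership in \<open>bloch\<close> makes the norms of the differences genuine
    suprema, so that their smallness controls derivatives.\<close>
  have FB: "F n \<circ> \<phi> \<in> bloch" for n using comp Fb by (simp add: compact_comp_op_def)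
  have chain: "fderiv (F n \<circ> \<phi>) x w = fderiv (F n) (\<phi> x) (fderiv \<phi> x w)" if "norm x < 1" for n x w
  proof -
    have "norm (\<phi> x) < 1" using self that by (force simp: image_subset_iff)
    then have "(F n has_derivative fderiv (F n) (\<phi> x)) (at (\<phi> x))" by (rule bloch_boundedD(1)[OF F(1)])
    moreover have "(\<phi> has_derivative fderiv \<phi> x) (at x)"
      using holo_vec_has_derivative[OF holo] that by simp
    ultimately have "((F n \<circ> \<phi>) has_derivative (\<lambda>w. fderiv (F n) (\<phi> x) (fderiv \<phi> x w))) (at x)"
      using has_derivative_compose by (fastforce simp: comp_def)
    then show ?thesis by (simp add: fderiv_eq)
  qed
  have bound: "(1 - (norm x)\<^sup>2) * cmod (fderiv (F (r n)) (\<phi> x) (fderiv \<phi> x w) - fderiv g x w) \<le> 2 * \<beta> n * norm w"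
    if "norm x < 1" for n x w
    using bloch_norm_ge_fderiv[OF bloch_diff(1)[OF FB g] that, of "r n" w]
    unfolding bloch_diff(2)[OF FB g that] chain[OF that] \<beta>_def by simp
  have \<beta>: "\<beta> \<longlonglongrightarrow> 0" using lim by (simp add: \<beta>_def)
  \<comment> \<open>At a fixed \<open>x\<close> both sides of \<open>bound\<close> converge, the
    right one to 0, which forces the derivative of \<open>g\<close> to vanish.\<close>
  have g0: "fderiv g x w = 0" if x: "norm x < 1" for x w
  proof -
    have "norm (\<phi> x) < 1" using self that by (force simp: image_subset_iff)
    then have "(\<lambda>n. fderiv (F (r n)) (\<phi> x) (fderiv \<phi> x w)) \<longlonglongrightarrow> 0"
      using LIMSEQ_subseq_LIMSEQ[OF null r] by (auto simp: comp_def)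
    then have "(\<lambda>n. (1 - (norm x)\<^sup>2) * cmod (fderiv (F (r n)) (\<phi> x) (fderiv \<phi> x w) - fderiv g x w))
        \<longlonglongrightarrow> (1 - (norm x)\<^sup>2) * cmod (0 - fderiv g x w)"
      by (intro tendsto_intros)
    moreover have "(\<lambda>n. 2 * \<beta> n * norm w) \<longlonglongrightarrow> 2 * 0 * norm w" by (intro tendsto_intros \<beta>)
    ultimately have "(1 - (norm x)\<^sup>2) * cmod (0 - fderiv g x w) \<le> 2 * 0 * norm w"
      using bound[OF x] by (intro LIMSEQ_le) auto
    then show ?thesis using one_minus_norm_square_pos[OF x] by (auto simp: mult_le_0_iff)
  qed
  \<comment> \<open>As \<open>bound\<close> is uniform in the point, it applies at the moving points
    \<open>z (r n)\<close>; taking the point itself as direction produces the radial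
    derivative.\<close>
  have "(\<lambda>n. (1 - (norm (z (r n)))\<^sup>2) * cmod (fderiv (F (r n)) (\<phi> (z (r n))) (radial_deriv \<phi> (z (r n))))) \<longlonglongrightarrow> 0"
  proof (rule Lim_null_comparison)
    have \<beta>0: "0 \<le> \<beta> n" for n
      using bloch_norm_ge_0[OF bloch_diff(1)[OF FB g], of "r n"] unfolding \<beta>_def
      by (rule order_trans[OF norm_ge_zero])
    have "norm ((1 - (norm (z (r n)))\<^sup>2) * cmod (fderiv (F (r n)) (\<phi> (z (r n))) (radial_deriv \<phi> (z (r n))))) \<le> 2 * \<beta> n" for n
    proof -
      have zn: "norm (z (r n)) < 1" by (rule z)
      have "(1 - (norm (z (r n)))\<^sup>2) * cmod (fderiv (F (r n)) (\<phi> (z (r n))) (radial_deriv \<phi> (z (r n)))) \<le> 2 * \<beta> n * norm (z (r n))"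
        using bound[OF zn, of n "z (r n)"] g0[OF zn] by (simp add: radial_deriv_def)
      also have "\<dots> \<le> 2 * \<beta> n" using zn \<beta>0[of n] by (intro mult_left_le) auto
      finally show ?thesis using one_minus_norm_square_pos[OF zn] by simp
    qed
    then show "\<forall>\<^sub>F n in sequentially. norm ((1 - (norm (z (r n)))\<^sup>2) *
        cmod (fderiv (F (r n)) (\<phi> (z (r n))) (radial_deriv \<phi> (z (r n))))) \<le> 2 * \<beta> n" by simp
    show "(\<lambda>n. 2 * \<beta> n) \<longlonglongrightarrow> 0" using tendsto_mult_right_zero[OF \<beta>, of 2] by simp
  qed
  then show thesis using r that by blast
qed

section \<open>The limits (3) and (2)\<close>

lemma not_limit_at_sphere_sequence:
  fixes N Q :: "'b \<Rightarrow> real"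
  assumes not: "\<not> (\<exists>r<1. \<forall>z\<in>S. N z > r \<longrightarrow> \<bar>Q z\<bar> < \<epsilon>)" and N: "\<And>z. z \<in> S \<Longrightarrow> N z < 1"
  obtains z :: "nat \<Rightarrow> 'b" where "\<And>n. z n \<in> S" "\<And>n. 1/2 < N (z n)" "\<And>n. \<epsilon> \<le> \<bar>Q (z n)\<bar>"
    "(\<lambda>n. N (z n)) \<longlonglongrightarrow> 1"
proof -
  \<comment> \<open>The shift by 2 makes the first threshold 1/2. The resulting bound keeps the
    values of \<open>\<phi>\<close> away from the origin when a radial component is later recovered
    from an inner product.\<close>
  have "\<exists>z\<in>S. N z > 1 - 1 / real (n + 2) \<and> \<epsilon> \<le> \<bar>Q z\<bar>" for n
  proof (rule ccontr)
    assume "\<not> ?thesis"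
    then have "\<forall>z\<in>S. N z > 1 - 1 / real (n + 2) \<longrightarrow> \<bar>Q z\<bar> < \<epsilon>"
      using not_le by blast
    moreover have "1 - 1 / real (n + 2) < 1" by simp
    ultimately show False using not by blast
  qed
  then obtain z where z: "\<And>n. z n \<in> S" "\<And>n. N (z n) > 1 - 1 / real (n + 2)" "\<And>n. \<epsilon> \<le> \<bar>Q (z n)\<bar>"
    by metis
  have lim: "(\<lambda>n. 1 - 1 / real (n + 2)) \<longlonglongrightarrow> 1"
    using tendsto_diff[OF tendsto_const LIMSEQ_ignore_initial_segment[OF lim_1_over_n, of 2], of 1] by simp
  have "(\<lambda>n. N (z n)) \<longlonglongrightarrow> 1"
    by (rule tendsto_sandwich[OF _ _ lim tendsto_const])
      (use z(2) N[OF z(1)] in \<open>auto intro!: always_eventually less_imp_le\<close>)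
  moreover have "1/2 < N (z n)" for n
  proof -
    have "1 / real (n + 2) \<le> 1 / 2" by (intro divide_left_mono) auto
    then show ?thesis using z(2)[of n] by linarith
  qed
  ultimately show thesis using that z by blast
qed

lemma compact_comp_op_radial_limit:
  fixes \<phi> :: "'a::chilbert_space \<Rightarrow> 'a"
  assumes holo: "holo_vec (ball 0 1) \<phi>" and self: "\<phi> ` ball 0 1 \<subseteq> ball 0 1"
    and comp: "compact_comp_op \<phi>" and \<epsilon>: "0 < \<epsilon>"
  shows "\<exists>r<1. \<forall>z\<in>ball 0 1. norm (\<phi> z) > r \<longrightarrow>
    \<bar>(1 - (norm z)\<^sup>2) * cmod (cinner (\<phi> z) (radial_deriv \<phi> z)) / (1 - (norm (\<phi> z))\<^sup>2)\<bar> < \<epsilon>"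
proof (rule ccontr)
  assume neg: "\<not> ?thesis"
  have \<phi>: "norm (\<phi> z) < 1" if "z \<in> ball 0 1" for z using self that by (force simp: image_subset_iff)
  obtain z :: "nat \<Rightarrow> 'a" where z: "\<And>n. z n \<in> ball 0 1" and "\<And>n. 1/2 < norm (\<phi> (z n))"
    and Q: "\<And>n. \<epsilon> \<le> \<bar>(1 - (norm (z n))\<^sup>2) * cmod (cinner (\<phi> (z n)) (radial_deriv \<phi> (z n))) / (1 - (norm (\<phi> (z n)))\<^sup>2)\<bar>"
    and lim: "(\<lambda>n. norm (\<phi> (z n))) \<longlonglongrightarrow> 1"
    by (rule not_limit_at_sphere_sequence[OF neg], erule \<phi>) (rule that)
  have a: "norm (\<phi> (z n)) < 1" for n by (rule \<phi>[OF z])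
  have z1: "norm (z n) < 1" for n using z[of n] by simp
  have F0: "cmod (radial_test (\<phi> (z n)) 0) \<le> 1" for n
    using one_minus_norm_square_pos[OF a[of n]] by (simp add: radial_test_def norm_of_real del: of_real_diff)
  obtain r :: "nat \<Rightarrow> nat" where r: "strict_mono r"
    and r0: "(\<lambda>n. (1 - (norm (z (r n)))\<^sup>2) * cmod (fderiv (radial_test (\<phi> (z (r n)))) (\<phi> (z (r n))) (radial_deriv \<phi> (z (r n))))) \<longlonglongrightarrow> 0"
    by (rule compact_comp_op_null_sequence[OF holo self comp bloch_bounded_radial_test[OF a] F0
          radial_test_fderiv_tendsto_0[OF a lim] z1])
  have "\<epsilon> \<le> (1 - (norm (z (r n)))\<^sup>2) * cmod (fderiv (radial_test (\<phi> (z (r n)))) (\<phi> (z (r n))) (radial_deriv \<phi> (z (r n))))" for n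
  proof -
    have "cmod (cinner (\<phi> (z (r n))) (radial_deriv \<phi> (z (r n)))) = cmod (cinner (radial_deriv \<phi> (z (r n))) (\<phi> (z (r n))))"
      by (metis cinner_commute complex_mod_cnj)
    then show ?thesis
      using Q[of "r n"] one_minus_norm_square_pos[OF a[of "r n"]] one_minus_norm_square_pos[OF z1[of "r n"]]
      by (simp add: fderiv_radial_test_self[OF a] norm_divide abs_mult del: of_real_diff)
  qed
  with r0 have "\<epsilon> \<le> 0" by (intro LIMSEQ_le_const) auto
  with \<epsilon> show False by simp
qed

text \<open>The radial derivative splits into parts along \<open>\<phi> z\<close> and orthogonal to
  it. The tangential test functions handle the orthogonal part, and the limit (3) handles the other,
  its denominator being the smaller one.\<close>

lemma compact_comp_op_norm_limit:
  fixes \<phi> :: "'a::chilbert_space \<Rightarrow> 'a"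
  assumes holo: "holo_vec (ball 0 1) \<phi>" and self: "\<phi> ` ball 0 1 \<subseteq> ball 0 1"
    and comp: "compact_comp_op \<phi>" and \<epsilon>: "0 < \<epsilon>"
  shows "\<exists>r<1. \<forall>z\<in>ball 0 1. norm (\<phi> z) > r \<longrightarrow>
    \<bar>(1 - (norm z)\<^sup>2) * norm (radial_deriv \<phi> z) / sqrt (1 - (norm (\<phi> z))\<^sup>2)\<bar> < \<epsilon>"
proof (rule ccontr)
  assume neg: "\<not> ?thesis"
  have \<phi>: "norm (\<phi> z) < 1" if "z \<in> ball 0 1" for z using self that by (force simp: image_subset_iff)
  obtain z :: "nat \<Rightarrow> 'a" where z: "\<And>n. z n \<in> ball 0 1" and half: "\<And>n. 1/2 < norm (\<phi> (z n))"
    and Q: "\<And>n. \<epsilon> \<le> \<bar>(1 - (norm (z n))\<^sup>2) * norm (radial_deriv \<phi> (z n)) / sqrt (1 - (norm (\<phi> (z n)))\<^sup>2)\<bar>"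
    and lim: "(\<lambda>n. norm (\<phi> (z n))) \<longlonglongrightarrow> 1"
    by (rule not_limit_at_sphere_sequence[OF neg], erule \<phi>) (rule that)
  define a where "a = (\<lambda>n. \<phi> (z n))"
  define R where "R = (\<lambda>n. radial_deriv \<phi> (z n))"
  define q where "q = (\<lambda>n. projQ (a n) (R n))"
  \<comment> \<open>If \<open>q n\<close> is 0, division by zero makes \<open>u n\<close> equal to
    0, which still has norm at most 1 and is orthogonal to \<open>a n\<close>.\<close>
  define u where "u = (\<lambda>n. (1 / norm (q n)) *\<^sub>R q n)"
  define s where "s = (\<lambda>n. sqrt (1 - (norm (a n))\<^sup>2))"
  define t where "t = (\<lambda>n. 1 - (norm (z n))\<^sup>2)"
  have a1: "norm (a n) < 1" for n unfolding a_def by (rule \<phi>[OF z])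
  have lim': "(\<lambda>n. norm (a n)) \<longlonglongrightarrow> 1" using lim by (simp add: a_def)
  have z1: "norm (z n) < 1" for n using z[of n] by simp
  have u1: "norm (u n) \<le> 1" "cinner (u n) (a n) = 0" for n
    by (simp_all add: u_def q_def cinner_scaleR_left)
  have s: "0 < s n" "s n \<le> 1" "s n * s n = 1 - (norm (a n))\<^sup>2" for n
    using one_minus_norm_square_pos[OF a1[of n]] by (simp_all add: s_def)
  have t: "0 < t n" for n using one_minus_norm_square_pos[OF z1[of n]] by (simp add: t_def)
  have F0: "cmod (tangential_test (a n) (u n) 0) \<le> 0" for n by (simp add: tangential_test_def)
  obtain r :: "nat \<Rightarrow> nat" where r: "strict_mono r"
    and r0: "(\<lambda>n. (1 - (norm (z (r n)))\<^sup>2) * cmod (fderiv (tangential_test (a (r n)) (u (r n))) (\<phi> (z (r n))) (radial_deriv \<phi> (z (r n))))) \<longlonglongrightarrow> 0"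
    by (rule compact_comp_op_null_sequence[OF holo self comp bloch_bounded_tangential_test[OF a1 u1] F0
          tangential_test_fderiv_tendsto_0[OF a1 lim' u1(1)] z1])
  have tang: "t n * cmod (fderiv (tangential_test (a n) (u n)) (\<phi> (z n)) (radial_deriv \<phi> (z n))) = t n * norm (q n) / s n" for n
  proof -
    have "cinner (projP (a n) (R n)) (u n) = 0" by (simp add: u_def q_def cinner_scaleR_right)
    then have "cinner (R n) (u n) = cinner (q n) (u n)" by (simp add: q_def projQ_def cinner_diff_left)
    also have "\<dots> = of_real (norm (q n))"
      by (simp add: u_def cinner_scaleR_right cinner_self power2_eq_square)
    finally have "cmod (fderiv (tangential_test (a n) (u n)) (a n) (R n)) = norm (q n) / s n"
      using s(1)[of n] by (simp add: fderiv_tangential_test_self[OF a1 u1(2)] norm_divide s_def)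
    then show ?thesis by (simp add: a_def R_def)
  qed
  \<comment> \<open>The factor 2 comes from \<open>norm (a n) > 1/2\<close>, and
    \<open>s n \<le> 1\<close> allows the denominator \<open>s n * s n\<close>. This is why (3) is
    used below with a quarter of \<open>\<epsilon>\<close>.\<close>
  have rad: "t n * norm (projP (a n) (R n)) / s n \<le> 2 * (t n * cmod (cinner (a n) (R n)) / (s n * s n))" for n
  proof -
    have "norm (projP (a n) (R n)) \<le> 2 * (norm (a n) * norm (projP (a n) (R n)))"
      using mult_right_mono[of "1/2" "norm (a n)" "norm (projP (a n) (R n))"] half[of n] by (simp add: a_def)
    also have "norm (a n) * norm (projP (a n) (R n)) = cmod (cinner (a n) (R n))"
      unfolding norm_projP by (metis cinner_commute complex_mod_cnj)
    finally have "t n * norm (projP (a n) (R n)) / s n \<le> t n * (2 * cmod (cinner (a n) (R n))) / s n"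
      using s(1)[of n] t[of n] by (intro divide_right_mono mult_left_mono) auto
    also have "\<dots> \<le> t n * (2 * cmod (cinner (a n) (R n))) / (s n * s n)"
      using s(1,2)[of n] t[of n] by (intro divide_left_mono mult_left_le) auto
    finally show ?thesis by (simp add: mult.left_commute)
  qed
  have \<epsilon>4: "0 < \<epsilon> / 4" using \<epsilon> by simp
  obtain \<rho> where \<rho>: "\<rho> < 1" "\<And>z. z \<in> ball 0 1 \<Longrightarrow> norm (\<phi> z) > \<rho> \<Longrightarrow>
    \<bar>(1 - (norm z)\<^sup>2) * cmod (cinner (\<phi> z) (radial_deriv \<phi> z)) / (1 - (norm (\<phi> z))\<^sup>2)\<bar> < \<epsilon> / 4"
    using compact_comp_op_radial_limit[OF holo self comp \<epsilon>4] by blast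
  have "(\<lambda>n. norm (\<phi> (z (r n)))) \<longlonglongrightarrow> 1"
    by (rule LIMSEQ_subseq_LIMSEQ[OF lim r, unfolded comp_def])
  then have "\<forall>\<^sub>F n in sequentially. \<rho> < norm (\<phi> (z (r n)))" using \<rho>(1) by (rule order_tendstoD)
  moreover have "\<forall>\<^sub>F n in sequentially. t (r n) * norm (q (r n)) / s (r n) < \<epsilon> / 2"
  proof (rule order_tendstoD(2))
    show "(\<lambda>n. t (r n) * norm (q (r n)) / s (r n)) \<longlonglongrightarrow> 0"
      using r0 unfolding tang[symmetric] by (simp only: t_def)
  qed (use \<epsilon> in simp)
  ultimately have "\<forall>\<^sub>F n in sequentially. False"
  proof eventually_elim
    case (elim n)
    define m where "m = r n"
    have "\<epsilon> \<le> t m * norm (R m) / s m"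
      using Q[of m] s(1)[of m] t[of m] by (simp add: t_def R_def s_def a_def abs_mult)
    also have "norm (R m) \<le> norm (q m) + norm (projP (a m) (R m))"
      using norm_triangle_ineq[of "q m" "projP (a m) (R m)"] by (simp add: q_def projQ_def)
    then have "t m * norm (R m) / s m \<le> t m * norm (q m) / s m + t m * norm (projP (a m) (R m)) / s m"
      using s(1)[of m] t[of m] unfolding add_divide_distrib[symmetric] distrib_left[symmetric]
      by (intro divide_right_mono mult_left_mono) auto
    also have "\<dots> < \<epsilon> / 2 + 2 * (\<epsilon> / 4)"
    proof -
      have "t m * cmod (cinner (a m) (R m)) / (s m * s m) < \<epsilon> / 4"
        using le_less_trans[OF abs_ge_self \<rho>(2)[OF z, of m]] elim(1) unfolding s(3) by (simp add: t_def R_def a_def m_def)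
      then show ?thesis using rad[of m] elim(2) unfolding m_def[symmetric] by linarith
    qed
    finally show False by simp
  qed
  then show False by simp
qed

section \<open>Relative compactness of the images of smaller balls\<close>

text \<open>Greedy selection: the terms chosen so far form a finite set, which the hypothesis
  avoids. With \<open>R\<close> read as separation, it yields a separated sequence of functionals in
  one use and of points in the other.\<close>

lemma no_finite_net_sequence:
  assumes "\<And>k. finite k \<Longrightarrow> \<exists>x\<in>S. \<forall>y\<in>k. R x y"
  shows "\<exists>u. \<forall>n::nat. u n \<in> S \<and> (\<forall>m<n. R (u n) (u m))"
proof (rule dependent_wellorder_choice)
  fix n :: nat and u
  show "\<exists>x. x \<in> S \<and> (\<forall>m<n. R x (u m))" using assms[of "u ` {..<n}"] by auto
qed simp

text \<open>Bolzano-Weierstrass in the complex plane, refining the subsequence once for each member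
  of \<open>K\<close>.\<close>

lemma cinner_convergent_subsequence:
  fixes p :: "nat \<Rightarrow> 'a::chilbert_space"
  assumes "finite K" and p: "\<And>n. norm (p n) \<le> 1"
  shows "\<exists>r::nat \<Rightarrow> nat. strict_mono r \<and> (\<forall>w\<in>K. convergent (\<lambda>n. cinner (p (r n)) w))"
  using assms(1)
proof (induction K)
  case empty
  show ?case by (auto intro!: exI[of _ id] strict_mono_id)
next
  case (insert w K)
  then obtain r :: "nat \<Rightarrow> nat" where r: "strict_mono r" "\<forall>w\<in>K. convergent (\<lambda>n. cinner (p (r n)) w)"
    by blast
  have "cmod (cinner (p (r n)) w) \<le> norm w" for n
    using cinner_Cauchy_Schwarz[of "p (r n)" w] mult_right_mono[OF p[of "r n"], of "norm w"] by simp
  then have "bounded (range (\<lambda>n. cinner (p (r n)) w))" by (auto simp: bounded_iff)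
  then obtain l and s :: "nat \<Rightarrow> nat" where s: "strict_mono s" "((\<lambda>n. cinner (p (r n)) w) \<circ> s) \<longlonglongrightarrow> l"
    using bounded_imp_convergent_subsequence by blast
  have "convergent (\<lambda>n. cinner (p ((r \<circ> s) n)) v)" if "v \<in> insert w K" for v
  proof (cases "v = w")
    case True
    then show ?thesis using s(2) by (auto simp: convergent_def comp_def)
  next
    case False
    then have "convergent ((\<lambda>n. cinner (p (r n)) v) \<circ> s)"
      using that r(2) s(1) by (intro convergent_subseq_convergent) auto
    then show ?thesis by (simp add: comp_def)
  qed
  moreover have "strict_mono (r \<circ> s)" using r(1) s(1) by (rule strict_mono_o)
  ultimately show ?case by blast
qed

text \<open>Compactness of the composition operator on the linear functionals, as in Schauder's
  theorem on adjoints.\<close>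
lemma compact_comp_op_finite_net:
  fixes \<phi> :: "'a::chilbert_space \<Rightarrow> 'a"
  assumes comp: "compact_comp_op \<phi>" and \<delta>: "0 < \<delta>" "\<delta> < 1" and e: "0 < e"
  shows "\<exists>K. finite K \<and> (\<forall>u. norm u \<le> 1 \<longrightarrow>
    (\<exists>w\<in>K. \<forall>x. norm x < \<delta> \<longrightarrow> cmod (cinner (\<phi> x) u - cinner (\<phi> x) w) < e))"
proof (rule ccontr)
  assume no: "\<not> ?thesis"
  define R where "R = (\<lambda>u w. \<exists>x. norm x < \<delta> \<and> e \<le> cmod (cinner (\<phi> x) u - cinner (\<phi> x) w))"
  have "\<exists>u\<in>cball 0 1. \<forall>w\<in>K. R u w" if "finite K" for K
  proof (rule ccontr)
    assume "\<not> ?thesis"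
    then have "\<exists>w\<in>K. \<forall>x. norm x < \<delta> \<longrightarrow> cmod (cinner (\<phi> x) u - cinner (\<phi> x) w) < e" if "norm u \<le> 1" for u
      using that unfolding R_def by (simp add: not_le)
    with no \<open>finite K\<close> show False by blast
  qed
  from no_finite_net_sequence[of "cball 0 1" R, OF this]
  obtain u :: "nat \<Rightarrow> 'a" where u: "\<And>n. u n \<in> cball 0 1" "\<And>m n. m < n \<Longrightarrow> R (u n) (u m)"
    by auto
  have F: "bloch_bounded 1 (linear_test (u n))" for n
    using u(1)[of n] by (intro bloch_bounded_linear_test) simp
  have Fb: "linear_test (u n) \<in> bloch" for n using F by (auto simp: bloch_iff_bounded)
  have "bloch_norm (linear_test (u n)) \<le> 13" for n
    using bloch_norm_le[OF F[of n]] by (simp add: linear_test_def)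
  with Fb have "(\<forall>n. linear_test (u n) \<in> bloch) \<and> (\<exists>M. \<forall>n. bloch_norm (linear_test (u n)) \<le> M)" by blast
  from compact_comp_op_subsequence[OF comp this]
  obtain r g where r: "strict_mono (r :: nat \<Rightarrow> nat)" and g: "g \<in> bloch"
    and lim: "(\<lambda>n. bloch_norm (\<lambda>z. (linear_test (u (r n)) \<circ> \<phi>) z - g z)) \<longlonglongrightarrow> 0"
    by blast
  have FB: "linear_test (u n) \<circ> \<phi> \<in> bloch" for n using comp Fb by (simp add: compact_comp_op_def)
  define H where "H = (\<lambda>n z. (linear_test (u (r n)) \<circ> \<phi>) z - g z)"
  have H: "H n \<in> bloch" for n
    unfolding H_def by (rule bloch_diff(1)[OF FB g])
  \<comment> \<open>The value at 0 contributes 1, and the Lipschitz estimate on the ball of radius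
    \<open>\<delta>\<close> contributes the rest.\<close>
  define C where "C = 1 + 2 / (1 - \<delta>\<^sup>2)"
  have \<delta>2: "\<delta>\<^sup>2 < 1" using \<delta> by (simp add: power_less_one_iff abs_square_less_1)
  have C: "0 < C" using \<delta>2 by (simp add: C_def add_pos_nonneg)
  have bound: "cmod (H n x) \<le> C * bloch_norm (H n)" if x: "norm x < \<delta>" for n x
  proof -
    have b0: "0 \<le> bloch_norm (H n)" by (rule order_trans[OF norm_ge_zero bloch_norm_ge_0[OF H]])
    have "(norm x)\<^sup>2 \<le> 1 - (1 - \<delta>\<^sup>2)" using x by (simp add: power_mono)
    then have "cmod (H n x - H n 0) \<le> 2 * bloch_norm (H n) / (1 - \<delta>\<^sup>2) * norm (x - 0)"
      using \<delta>2 by (intro bloch_bounded_lipschitz[OF bloch_bounded_bloch_norm[OF H]]) auto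
    also have "\<dots> \<le> 2 * bloch_norm (H n) / (1 - \<delta>\<^sup>2)"
      using b0 \<delta>2 x \<delta> by (intro mult_left_le) auto
    finally have "cmod (H n x) \<le> cmod (H n 0) + 2 * bloch_norm (H n) / (1 - \<delta>\<^sup>2)"
      using norm_triangle_ineq2[of "H n x" "H n 0"] by linarith
    also have "\<dots> \<le> C * bloch_norm (H n)"
      using bloch_norm_ge_0[OF H[of n]] by (simp add: C_def distrib_right)
    finally show ?thesis .
  qed
  have "\<forall>\<^sub>F n in sequentially. bloch_norm (H n) < e / (2 * C)"
    using order_tendstoD(2)[OF lim, of "e / (2 * C)"] e C by (simp add: H_def)
  \<comment> \<open>Two consecutive terms are both close to \<open>g\<close>, hence to each other on
    the ball of radius \<open>\<delta>\<close>, against the separation of the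
    \<open>u n\<close>.\<close>
  then obtain n where n: "bloch_norm (H n) < e / (2 * C)" "bloch_norm (H (Suc n)) < e / (2 * C)"
    unfolding eventually_sequentially by (meson le_Suc_eq order_refl)
  have "r n < r (Suc n)" using r by (simp add: strict_mono_less)
  from u(2)[OF this] obtain x where x: "norm x < \<delta>"
    and ex: "e \<le> cmod (cinner (\<phi> x) (u (r (Suc n))) - cinner (\<phi> x) (u (r n)))"
    by (auto simp: R_def)
  have "cinner (\<phi> x) (u (r (Suc n))) - cinner (\<phi> x) (u (r n)) = H (Suc n) x - H n x"
    by (simp add: H_def linear_test_def)
  with ex have "e \<le> cmod (H (Suc n) x) + cmod (H n x)"
    using norm_triangle_ineq4[of "H (Suc n) x" "H n x"] by simp
  also have "\<dots> \<le> C * bloch_norm (H (Suc n)) + C * bloch_norm (H n)"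
    by (intro add_mono bound x)
  also have "\<dots> < C * (e / (2 * C)) + C * (e / (2 * C))"
    using n C by (intro add_strict_mono mult_strict_left_mono) auto
  also have "\<dots> = e" using C by simp
  finally show False by simp
qed

text \<open>Along an \<open>e\<close>-separated sequence of image points, pass to a subsequence on
  which the finitely many functionals of the net converge. They nearly vanish on consecutive
  differences, and the net transfers this to the functional that norms such a difference.\<close>

lemma compact_comp_op_image_totally_bounded:
  fixes \<phi> :: "'a::chilbert_space \<Rightarrow> 'a"
  assumes self: "\<phi> ` ball 0 1 \<subseteq> ball 0 1" and comp: "compact_comp_op \<phi>"
    and \<delta>: "0 < \<delta>" "\<delta> < 1" and e: "0 < e"
  shows "\<exists>k. finite k \<and> \<phi> ` ball 0 \<delta> \<subseteq> (\<Union>x\<in>k. ball x e)"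
proof (rule ccontr)
  assume no: "\<not> ?thesis"
  have "\<exists>x\<in>\<phi> ` ball 0 \<delta>. \<forall>y\<in>k. e \<le> dist y x" if "finite k" for k
  proof (rule ccontr)
    assume "\<not> ?thesis"
    then have "\<phi> ` ball 0 \<delta> \<subseteq> (\<Union>x\<in>k. ball x e)" by (force simp: not_le)
    with no that show False by blast
  qed
  from no_finite_net_sequence[of "\<phi> ` ball 0 \<delta>" "\<lambda>x y. e \<le> dist y x", OF this]
  obtain p :: "nat \<Rightarrow> 'a" where p: "\<And>n. p n \<in> \<phi> ` ball 0 \<delta>" "\<And>m n. m < n \<Longrightarrow> e \<le> dist (p m) (p n)"
    by metis
  have "\<exists>x. norm x < \<delta> \<and> p n = \<phi> x" for n using p(1)[of n] by auto
  then obtain x where x: "\<And>n. norm (x n) < \<delta>" "\<And>n. p n = \<phi> (x n)" by metis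
  have p1: "norm (p n) \<le> 1" for n
  proof -
    have "x n \<in> ball 0 1" using x(1)[of n] \<delta> by simp
    then have "\<phi> (x n) \<in> ball 0 1" using self by blast
    then show ?thesis by (simp add: x(2))
  qed
  have e4: "0 < e / 4" using e by simp
  obtain K where K: "finite K" "\<And>u. norm u \<le> 1 \<Longrightarrow>
      \<exists>w\<in>K. \<forall>x. norm x < \<delta> \<longrightarrow> cmod (cinner (\<phi> x) u - cinner (\<phi> x) w) < e / 4"
    using compact_comp_op_finite_net[OF comp \<delta> e4] by blast
  obtain r :: "nat \<Rightarrow> nat" where r: "strict_mono r" "\<And>w. w \<in> K \<Longrightarrow> convergent (\<lambda>n. cinner (p (r n)) w)"
    using cinner_convergent_subsequence[of K p, OF K(1) p1] by blast
  have "\<forall>\<^sub>F n in sequentially. cmod (cinner (p (r (Suc n)) - p (r n)) w) < e / 4" if "w \<in> K" for w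
  proof -
    obtain l where l: "(\<lambda>n. cinner (p (r n)) w) \<longlonglongrightarrow> l" using r(2)[OF \<open>w \<in> K\<close>] by (auto simp: convergent_def)
    have "(\<lambda>n. cmod (cinner (p (r (Suc n))) w - cinner (p (r n)) w)) \<longlonglongrightarrow> cmod (l - l)"
      by (intro tendsto_intros l LIMSEQ_Suc[OF l])
    then show ?thesis
      using order_tendstoD(2)[of _ 0 sequentially "e / 4"] e by (simp add: cinner_diff_left)
  qed
  then have "\<forall>\<^sub>F n in sequentially. \<forall>w\<in>K. cmod (cinner (p (r (Suc n)) - p (r n)) w) < e / 4"
    using K(1) by (simp add: eventually_ball_finite)
  then obtain n where n: "\<And>w. w \<in> K \<Longrightarrow> cmod (cinner (p (r (Suc n)) - p (r n)) w) < e / 4"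
    using eventually_happens'[OF sequentially_bot] by blast
  define q where "q = p (r (Suc n)) - p (r n)"
  have "r n < r (Suc n)" using r(1) by (simp add: strict_mono_less)
  then have q: "e \<le> norm q" using p(2) by (force simp: q_def dist_norm norm_minus_commute)
  \<comment> \<open>This unit vector recovers the norm of \<open>q\<close>. Replacing it by a nearby
    \<open>w\<close> costs \<open>e / 4\<close> at each of the two points, and \<open>w\<close>
    contributes a third \<open>e / 4\<close>, so \<open>norm q < e\<close>.\<close>
  define u where "u = (1 / norm q) *\<^sub>R q"
  have "norm u \<le> 1" by (simp add: u_def)
  from K(2)[OF this] obtain w where "w \<in> K"
    and near: "\<forall>x. norm x < \<delta> \<longrightarrow> cmod (cinner (\<phi> x) u - cinner (\<phi> x) w) < e / 4" by blast
  have w: "cmod (cinner (p n) u - cinner (p n) w) < e / 4" for n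
    using near[rule_format, OF x(1)[of n]] by (simp add: x(2))
  have "cinner q u = of_real (norm q)"
    by (simp add: u_def cinner_scaleR_right cinner_self power2_eq_square)
  then have "norm q = cmod (cinner q u)" by simp
  also have "cinner q u = cinner q w + (cinner (p (r (Suc n))) u - cinner (p (r (Suc n))) w)
      - (cinner (p (r n)) u - cinner (p (r n)) w)"
    by (simp add: q_def cinner_diff_left)
  also have "cmod \<dots> \<le> cmod (cinner q w) + cmod (cinner (p (r (Suc n))) u - cinner (p (r (Suc n))) w)
      + cmod (cinner (p (r n)) u - cinner (p (r n)) w)"
    by (intro order_trans[OF norm_triangle_ineq4] add_mono norm_triangle_ineq order_refl)
  also have "\<dots> < e / 4 + e / 4 + e / 4"
    using n[OF \<open>w \<in> K\<close>] w unfolding q_def by (intro add_strict_mono)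
  finally show False using q e by simp
qed

text \<open>A finite union of closed balls of half the radius is closed, so it covers the closure as
  well; completeness does the rest.\<close>

lemma compact_closure_if_totally_bounded:
  fixes S :: "'b::{real_normed_vector, complete_space} set"
  assumes "\<And>e. 0 < e \<Longrightarrow> \<exists>k. finite k \<and> S \<subseteq> (\<Union>x\<in>k. ball x e)"
  shows "compact (closure S)"
  unfolding compact_eq_totally_bounded
proof (intro conjI allI impI)
  show "complete (closure S)" by (simp add: complete_eq_closed)
  fix e :: real assume e: "0 < e"
  then obtain k where k: "finite k" "S \<subseteq> (\<Union>x\<in>k. ball x (e / 2))" using assms[of "e / 2"] by auto
  have "S \<subseteq> (\<Union>x\<in>k. cball x (e / 2))" using k(2) by force
  then have "closure S \<subseteq> (\<Union>x\<in>k. cball x (e / 2))"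
    using k(1) by (intro closure_minimal) auto
  also have "\<dots> \<subseteq> (\<Union>x\<in>k. ball x e)" using e by force
  finally show "\<exists>k. finite k \<and> closure S \<subseteq> (\<Union>x\<in>k. ball x e)" using k(1) by blast
qed

theorem theorem4p5:
  fixes \<phi> :: "'a::chilbert_space \<Rightarrow> 'a"
  assumes "holo_vec (ball 0 1) \<phi>"
    and "\<phi> ` ball 0 1 \<subseteq> ball 0 1"
    and "compact_comp_op \<phi>"
  shows "(\<forall>\<delta>. 0 < \<delta> \<and> \<delta> < 1 \<longrightarrow> compact (closure (\<phi> ` ((\<lambda>x. \<delta> *\<^sub>R x) ` ball 0 1)))) \<and>
         (\<forall>\<epsilon>>0. \<exists>r<1. \<forall>z\<in>ball 0 1. norm (\<phi> z) > r \<longrightarrow>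
           \<bar>(1 - (norm z)\<^sup>2) * norm (radial_deriv \<phi> z) / sqrt (1 - (norm (\<phi> z))\<^sup>2)\<bar> < \<epsilon>) \<and>
         (\<forall>\<epsilon>>0. \<exists>r<1. \<forall>z\<in>ball 0 1. norm (\<phi> z) > r \<longrightarrow>
           \<bar>(1 - (norm z)\<^sup>2) * cmod (cinner (\<phi> z) (radial_deriv \<phi> z)) / (1 - (norm (\<phi> z))\<^sup>2)\<bar> < \<epsilon>)"
proof (intro conjI allI impI)
  fix \<delta> :: real assume "0 < \<delta> \<and> \<delta> < 1"
  then have \<delta>: "0 < \<delta>" "\<delta> < 1" by auto
  have "(\<lambda>x. \<delta> *\<^sub>R x) ` ball 0 1 = ball (0 :: 'a) \<delta>"
    using ball_scale[of \<delta> "0 :: 'a" 1] \<delta> by simp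
  then show "compact (closure (\<phi> ` ((\<lambda>x. \<delta> *\<^sub>R x) ` ball 0 1)))"
    using compact_closure_if_totally_bounded[OF compact_comp_op_image_totally_bounded[OF assms(2,3) \<delta>]]
    by simp
qed (use compact_comp_op_norm_limit[OF assms] compact_comp_op_radial_limit[OF assms] in blast)+

end
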